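(* Let $\mathcal{L}$ be an operator on $\mathbb{R}^n$ satisfying the standing assumptions listed in the context. Let $u\in L^1_{\mathrm{loc}}(\mathbb{R}^n,\mathbb{R})$ be a solution to $\mathcal{L}u\ge 0$ in $\mathbb{R}^n$ in the weak sense of distributions. If $u\in L^p(\mathbb{R}^n,\mathbb{R})$ for some $p\in[1,\infty[$, then $u\le 0$ almost everywhere in $\mathbb{R}^n$.
   Context: Standing assumptions. $\mathcal{L}:=\mathrm{div}(A\nabla)+\langle b,\nabla\rangle$ is a linear second order partial differential operator on $\mathbb{R}^n$, where $A=(a_{ij})_{i,j=1,\dots,n}$ is a symmetric $n\times n$ matrix with entries $a_{ij}\in C^\infty(\mathbb{R}^n,\mathbb{R})$, $b=(b_1,\dots,b_n)$ has components $b_j\in C^\infty(\mathbb{R}^n,\mathbb{R})$, and $\mathrm{div}$, $\nabla$, $\langle\cdot,\cdot\rangle$ are the Euclidean divergence, gradient and inner product. It is assumed that $\langle A(x)\xi,\xi\rangle\ge 0$ for all $x,\xi\in\mathbb{R}^n$ and $\mathrm{trace}\,A(0)>0$. Moreover: (1) $\mathcal{L}$ is hypoelliptic: if $w$ is a distribution on an open set $\Omega\subseteq\mathbb{R}^n$ and $\mathcal{L}w$ is smooth in $\Omega$, then $w$ is smooth in $\Omega$. (2) There is a Lie group $\mathbb{G}=(\mathbb{R}^n,\circ)$ such that $\mathcal{L}$ is left translation invariant on $\mathbb{G}$, i.e. $\mathcal{L}(w(\alpha\circ\cdot))(x)=(\mathcal{L}w)(\alpha\circ x)$ for all $\alpha,x\in\mathbb{R}^n$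 and all $w\in C^\infty(\mathbb{R}^n,\mathbb{R})$. (3) The Lebesgue measure on $\mathbb{R}^n$ is both left and right invariant on $\mathbb{G}$. For $u\in L^1_{\mathrm{loc}}$, "$\mathcal{L}u\ge 0$ in the weak sense of distributions" means $\int_{\mathbb{R}^n}u\,\mathcal{L}^*\varphi\,dx\ge 0$ for every $\varphi\in C_0^\infty(\mathbb{R}^n,\mathbb{R})$ with $\varphi\ge 0$, where $\mathcal{L}^*\varphi=\mathrm{div}(A\nabla\varphi)-\mathrm{div}(b\varphi)$ is the formal adjoint of $\mathcal{L}$. $L^p$ is taken with respect to Lebesgue measure. *)

theory Defs
  imports "HOL-Analysis.Analysis" "HOL-Algebra.Group"
begin

section \<open>Smooth functions and test functions\<close>

text \<open>Both notions below are intended for open sets \<^term>\<open>S\<close> only.\<close>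

primrec Ck_on :: "nat \<Rightarrow> 'a::euclidean_space set \<Rightarrow> ('a \<Rightarrow> 'b::real_normed_vector) \<Rightarrow> bool" where
  "Ck_on 0 S f \<longleftrightarrow> continuous_on S f"
| "Ck_on (Suc k) S f \<longleftrightarrow>
     (\<forall>x\<in>S. f differentiable (at x)) \<and>
     (\<forall>v. Ck_on k S (\<lambda>x. frechet_derivative f (at x) v))"

definition smooth_on :: "'a::euclidean_space set \<Rightarrow> ('a \<Rightarrow> 'b::real_normed_vector) \<Rightarrow> bool" where
  "smooth_on S f \<longleftrightarrow> (\<forall>k. Ck_on k S f)"

definition supp :: "('a::topological_space \<Rightarrow> real) \<Rightarrow> 'a set" where
  "supp f = closure {x. f x \<noteq> 0}"

definition test_functions :: "'a::euclidean_space set \<Rightarrow> ('a \<Rightarrow> real) set" where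
  "test_functions \<Omega> = {\<phi>. smooth_on UNIV \<phi> \<and> compact (supp \<phi>) \<and> supp \<phi> \<subseteq> \<Omega>}"

section \<open>Differential operators\<close>

definition partial :: "'n \<Rightarrow> (real^'n::finite \<Rightarrow> real) \<Rightarrow> real^'n \<Rightarrow> real" where
  "partial i f x = frechet_derivative f (at x) (axis i 1)"

definition grad :: "(real^'n::finite \<Rightarrow> real) \<Rightarrow> real^'n \<Rightarrow> real^'n" where
  "grad f x = (\<chi> i. partial i f x)"

definition divergence :: "(real^'n::finite \<Rightarrow> real^'n) \<Rightarrow> real^'n \<Rightarrow> real" where
  "divergence F x = (\<Sum>i\<in>UNIV. partial i (\<lambda>y. F y $ i) x)"

definition diff_op ::
    "(real^'n \<Rightarrow> real^'n^'n::finite) \<Rightarrow> (real^'n \<Rightarrow> real^'n) \<Rightarrow> (real^'n \<Rightarrow> real) \<Rightarrow> real^'n \<Rightarrow> real" where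
  "diff_op A b w x = divergence (\<lambda>y. A y *v grad w y) x + b x \<bullet> grad w x"

definition adjoint_op ::
    "(real^'n \<Rightarrow> real^'n^'n::finite) \<Rightarrow> (real^'n \<Rightarrow> real^'n) \<Rightarrow> (real^'n \<Rightarrow> real) \<Rightarrow> real^'n \<Rightarrow> real" where
  "adjoint_op A b \<phi> x =
     divergence (\<lambda>y. A y *v grad \<phi> y) x - divergence (\<lambda>y. \<phi> y *\<^sub>R b y) x"

section \<open>Distributions and hypoellipticity\<close>

text \<open>The list \<open>is\<close> of coordinate directions plays the role of a multi-index of order
  \<^term>\<open>length is\<close>.\<close>

primrec iter_partial :: "'n list \<Rightarrow> (real^'n::finite \<Rightarrow> real) \<Rightarrow> real^'n \<Rightarrow> real" where
  "iter_partial [] f = f"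
| "iter_partial (i # is) f = partial i (iter_partial is f)"

definition Ck_norm :: "nat \<Rightarrow> (real^'n::finite \<Rightarrow> real) \<Rightarrow> real" where
  "Ck_norm m \<phi> = (\<Sum>is | length is \<le> m. SUP x. \<bar>iter_partial is \<phi> x\<bar>)"

text \<open>Distributions are total functions of which only the values on
  \<^term>\<open>test_functions \<Omega>\<close> matter.\<close>

definition distribution_on :: "(real^'n::finite) set \<Rightarrow> ((real^'n \<Rightarrow> real) \<Rightarrow> real) \<Rightarrow> bool" where
  "distribution_on \<Omega> T \<longleftrightarrow>
     (\<forall>\<phi>\<in>test_functions \<Omega>. \<forall>\<psi>\<in>test_functions \<Omega>. T (\<lambda>x. \<phi> x + \<psi> x) = T \<phi> + T \<psi>) \<and>
     (\<forall>c. \<forall>\<phi>\<in>test_functions \<Omega>. T (\<lambda>x. c * \<phi> x) = c * T \<phi>) \<and>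
     (\<forall>K. compact K \<and> K \<subseteq> \<Omega> \<longrightarrow>
        (\<exists>C m. \<forall>\<phi>\<in>test_functions \<Omega>. supp \<phi> \<subseteq> K \<longrightarrow> \<bar>T \<phi>\<bar> \<le> C * Ck_norm m \<phi>))"

definition smooth_distribution_on :: "(real^'n::finite) set \<Rightarrow> ((real^'n \<Rightarrow> real) \<Rightarrow> real) \<Rightarrow> bool" where
  "smooth_distribution_on \<Omega> T \<longleftrightarrow>
     (\<exists>f. smooth_on \<Omega> f \<and> (\<forall>\<phi>\<in>test_functions \<Omega>. T \<phi> = (LINT x|lebesgue. f x * \<phi> x)))"

text \<open>As a distribution, the image of \<open>T\<close> under the operator is \<open>\<phi> \<mapsto> T (adjoint_op A b \<phi>)\<close>.\<close>

definition hypoelliptic ::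
    "(real^'n \<Rightarrow> real^'n^'n::finite) \<Rightarrow> (real^'n \<Rightarrow> real^'n) \<Rightarrow> bool" where
  "hypoelliptic A b \<longleftrightarrow>
     (\<forall>\<Omega> T. open \<Omega> \<and> distribution_on \<Omega> T \<and>
        smooth_distribution_on \<Omega> (\<lambda>\<phi>. T (adjoint_op A b \<phi>)) \<longrightarrow>
        smooth_distribution_on \<Omega> T)"

section \<open>Lie groups on Euclidean space\<close>

definition lie_group :: "(real^'n::finite) monoid \<Rightarrow> bool" where
  "lie_group G \<longleftrightarrow> group G \<and> carrier G = UNIV \<and>
     smooth_on UNIV (\<lambda>(x, y). x \<otimes>\<^bsub>G\<^esub> y) \<and> smooth_on UNIV (\<lambda>x. inv\<^bsub>G\<^esub> x)"

definition left_translation_invariant_op ::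
    "(real^'n::finite) monoid \<Rightarrow> ((real^'n \<Rightarrow> real) \<Rightarrow> real^'n \<Rightarrow> real) \<Rightarrow> bool" where
  "left_translation_invariant_op G L \<longleftrightarrow>
     (\<forall>\<alpha> x w. smooth_on UNIV w \<longrightarrow> L (\<lambda>y. w (\<alpha> \<otimes>\<^bsub>G\<^esub> y)) x = L w (\<alpha> \<otimes>\<^bsub>G\<^esub> x))"

definition left_invariant_lebesgue :: "(real^'n::finite) monoid \<Rightarrow> bool" where
  "left_invariant_lebesgue G \<longleftrightarrow>
     (\<forall>\<alpha>. \<forall>E\<in>sets lebesgue. emeasure lebesgue ((\<lambda>x. \<alpha> \<otimes>\<^bsub>G\<^esub> x) ` E) = emeasure lebesgue E)"

definition right_invariant_lebesgue :: "(real^'n::finite) monoid \<Rightarrow> bool" where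
  "right_invariant_lebesgue G \<longleftrightarrow>
     (\<forall>\<alpha>. \<forall>E\<in>sets lebesgue. emeasure lebesgue ((\<lambda>x. x \<otimes>\<^bsub>G\<^esub> \<alpha>) ` E) = emeasure lebesgue E)"

section \<open>Function spaces and weak subsolutions\<close>

definition L1_loc :: "('a::euclidean_space \<Rightarrow> real) set" where
  "L1_loc = {u. \<forall>K. compact K \<longrightarrow> set_integrable lebesgue K u}"

definition Lp :: "real \<Rightarrow> ('a::euclidean_space \<Rightarrow> real) set" where
  "Lp p = {u. u \<in> borel_measurable lebesgue \<and> integrable lebesgue (\<lambda>x. \<bar>u x\<bar> powr p)}"

definition weak_subsolution ::
    "(real^'n \<Rightarrow> real^'n^'n::finite) \<Rightarrow> (real^'n \<Rightarrow> real^'n) \<Rightarrow> (real^'n \<Rightarrow> real) \<Rightarrow> bool" where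
  "weak_subsolution A b u \<longleftrightarrow>
     (\<forall>\<phi>\<in>test_functions UNIV. (\<forall>x. \<phi> x \<ge> 0) \<longrightarrow>
        (LINT x|lebesgue. u x * adjoint_op A b \<phi> x) \<ge> 0)"

end

theory Submission
  imports Defs
begin

text \<open>
  Averaging \<open>u\<close> over left translates, \<open>w x = \<integral> \<phi>(\<alpha>) u(\<alpha> x) d\<alpha>\<close>, gives a smooth subsolution, since
  the adjoint operator is left invariant by duality; at the neutral element \<open>w = \<integral> \<phi> u\<close>, so it
  suffices to prove \<open>w \<le> 0\<close>. Let \<open>F\<close> be smooth, zero on \<open>t \<le> 0\<close>, increasing and strictly convex on
  \<open>t > 0\<close>, and bounded by a multiple of \<open>\<bar>t\<bar>\<^sup>p\<close>. By Jensen's inequality \<open>v = F(w)\<close> is integrable, and it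
  is again a subsolution. For a test function \<open>\<psi> \<ge> 0\<close> the function
  \<open>g y = \<integral> (Lv)(y z) \<psi>(z) dz = \<integral> v(y z) L\<^sup>*\<psi>(z) dz\<close> is nonnegative, and by Fubini and right
  invariance \<open>\<integral> g = (\<integral> v) (\<integral> L\<^sup>*\<psi>) = 0\<close>, because \<open>L\<close> annihilates constants. Hence \<open>Lv = 0\<close>, and the
  chain rule yields \<open>Lw = 0\<close> and \<open>\<langle>A \<nabla>w, \<nabla>w\<rangle> = 0\<close> on \<open>{w > 0}\<close>. Then every function of \<open>w\<close> that is
  constant on \<open>{w \<le> c}\<close> with \<open>c \<ge> 0\<close> is a solution, and approximating a step function makes the
  indicator of \<open>{w > c}\<close> a distributional solution. By hypoellipticity it is almost everywhere equal to
  a continuous \<open>{0,1}\<close>-valued function, so it is constant, and integrability of \<open>F(w)\<close> leaves only \<open>0\<close>.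
\<close>

section \<open>Calculus of smooth functions\<close>

lemma Ck_on_Suc_imp_Ck_on: "Ck_on (Suc k) S f \<Longrightarrow> Ck_on k S f"
proof (induction k arbitrary: f)
  case 0
  then show ?case
    by (auto intro!: continuous_at_imp_continuous_on differentiable_imp_continuous_within)
next
  case (Suc k)
  then show ?case by (metis Ck_on.simps(2))
qed

text \<open>Derivatives at a point are unique, so an explicitly known derivative may stand in for
  the \<open>frechet_derivative\<close> of the recursion. The closure properties below are proved by
  induction through this rule.\<close>

lemma Ck_on_SucI:
  assumes "\<And>x. (f has_derivative f' x) (at x)" "\<And>v. Ck_on k UNIV (\<lambda>x. f' x v)"
  shows "Ck_on (Suc k) UNIV f"
proof -
  have "frechet_derivative f (at x) = f' x" for x
    using frechet_derivative_at[OF assms(1)] by simp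
  with assms show ?thesis
    by (auto simp: differentiable_def)
qed

lemma Ck_on_SucD:
  assumes "Ck_on (Suc k) UNIV f"
  shows "(f has_derivative frechet_derivative f (at x)) (at x)"
    and "Ck_on k UNIV (\<lambda>x. frechet_derivative f (at x) v)"
  using assms by (auto simp: frechet_derivative_works)

lemma Ck_on_const: "Ck_on k UNIV (\<lambda>x. c)"
proof (induction k arbitrary: c)
  case (Suc k)
  show ?case
    by (rule Ck_on_SucI[where f'="\<lambda>x v. 0"]) (auto intro: Suc)
qed auto

lemma Ck_on_bounded_linear:
  assumes "bounded_linear l"
  shows "Ck_on k UNIV l"
proof (cases k)
  case 0
  then show ?thesis
    using assms by (simp add: linear_continuous_on)
next
  case (Suc k)
  show ?thesis unfolding Suc
    by (rule Ck_on_SucI[where f'="\<lambda>x. l"])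
       (auto intro: bounded_linear_imp_has_derivative assms Ck_on_const)
qed

lemma Ck_on_add:
  "Ck_on k UNIV f \<Longrightarrow> Ck_on k UNIV g \<Longrightarrow> Ck_on k UNIV (\<lambda>x. f x + g x)"
proof (induction k arbitrary: f g)
  case 0
  then show ?case by (auto intro: continuous_on_add)
next
  case (Suc k)
  show ?case
    by (rule Ck_on_SucI[OF has_derivative_add])
       (use Ck_on_SucD[OF Suc.prems(1)] Ck_on_SucD[OF Suc.prems(2)] Suc.IH in auto)
qed

lemma Ck_on_sum:
  "(\<And>i. i \<in> I \<Longrightarrow> Ck_on k UNIV (f i)) \<Longrightarrow> Ck_on k UNIV (\<lambda>x. \<Sum>i\<in>I. f i x)"
  by (induction I rule: infinite_finite_induct) (auto intro: Ck_on_add Ck_on_const)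

text \<open>The Leibniz rule in one induction, for every bounded bilinear product at once:
  multiplication, scaling and inner product are all instances.\<close>

lemma Ck_on_bilinear:
  assumes "bounded_bilinear prd"
  shows "Ck_on k UNIV f \<Longrightarrow> Ck_on k UNIV g \<Longrightarrow> Ck_on k UNIV (\<lambda>x. prd (f x) (g x))"
proof (induction k arbitrary: f g)
  case 0
  then show ?case by (auto intro: bounded_bilinear.continuous_on[OF assms])
next
  case (Suc k)
  show ?case
    by (rule Ck_on_SucI[OF bounded_bilinear.FDERIV[OF assms]])
       (use Ck_on_SucD[OF Suc.prems(1)] Ck_on_SucD[OF Suc.prems(2)] Suc.IH
          Ck_on_Suc_imp_Ck_on[OF Suc.prems(1)] Ck_on_Suc_imp_Ck_on[OF Suc.prems(2)] in
          \<open>auto intro!: Ck_on_add\<close>)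
qed

lemma Ck_on_compose:
  fixes g :: "'a::euclidean_space \<Rightarrow> 'b::euclidean_space"
    and f :: "'b \<Rightarrow> 'c::real_normed_vector"
  shows "Ck_on k UNIV f \<Longrightarrow> Ck_on k UNIV g \<Longrightarrow> Ck_on k UNIV (\<lambda>x. f (g x))"
proof (induction k arbitrary: f g)
  case 0
  then show ?case by (auto intro: continuous_on_compose2)
next
  case (Suc k)
  let ?f' = "\<lambda>x. frechet_derivative f (at x)" and ?g' = "\<lambda>x. frechet_derivative g (at x)"
  have "Ck_on k UNIV (\<lambda>x. ?f' (g x) (?g' x v))" for v
  proof -
    have lin: "linear (?f' x)" for x
      using Ck_on_SucD(1)[OF Suc.prems(1)] has_derivative_linear by blast
    \<comment> \<open>The induction hypothesis only speaks of derivatives of \<open>f\<close> in a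
      fixed direction, whereas \<open>?g' x v\<close> moves with \<open>x\<close>. Expanding it in
      the basis leaves fixed directions \<open>b\<close> with \<open>C^k\<close>
      coefficients.\<close>
    have "?f' (g x) (?g' x v) = (\<Sum>b\<in>Basis. (?g' x v \<bullet> b) *\<^sub>R ?f' (g x) b)" for x
    proof -
      have "?f' (g x) (?g' x v) = ?f' (g x) (\<Sum>b\<in>Basis. (?g' x v \<bullet> b) *\<^sub>R b)"
        by (simp only: euclidean_representation)
      then show ?thesis
        by (simp add: linear_sum[OF lin] linear_cmul[OF lin])
    qed
    moreover have "Ck_on k UNIV (\<lambda>x. (?g' x v \<bullet> b) *\<^sub>R ?f' (g x) b)" for b
      by (intro Ck_on_bilinear[OF bounded_bilinear_scaleR] Ck_on_bilinear[OF bounded_bilinear_inner]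
          Ck_on_const Ck_on_SucD(2)[OF Suc.prems(2)]
          Suc.IH[OF Ck_on_SucD(2)[OF Suc.prems(1)] Ck_on_Suc_imp_Ck_on[OF Suc.prems(2)]])
    ultimately show ?thesis
      by (simp add: Ck_on_sum)
  qed
  then show ?case
    using has_derivative_compose[OF Ck_on_SucD(1)[OF Suc.prems(2)] Ck_on_SucD(1)[OF Suc.prems(1)]]
    by (intro Ck_on_SucI) auto
qed

section \<open>Closure properties of smooth functions on the whole space\<close>

lemma smooth_on_const [simp]: "smooth_on UNIV (\<lambda>x. c)"
  by (simp add: smooth_on_def Ck_on_const)

lemma smooth_on_bounded_linear: "bounded_linear l \<Longrightarrow> smooth_on UNIV l"
  by (simp add: smooth_on_def Ck_on_bounded_linear)

lemma smooth_on_add: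
  "smooth_on UNIV f \<Longrightarrow> smooth_on UNIV g \<Longrightarrow> smooth_on UNIV (\<lambda>x. f x + g x)"
  by (simp add: smooth_on_def Ck_on_add)

lemma smooth_on_sum:
  "(\<And>i. i \<in> I \<Longrightarrow> smooth_on UNIV (f i)) \<Longrightarrow> smooth_on UNIV (\<lambda>x. \<Sum>i\<in>I. f i x)"
  by (simp add: smooth_on_def Ck_on_sum)

lemma smooth_on_bilinear:
  assumes "bounded_bilinear prd" "smooth_on UNIV f" "smooth_on UNIV g"
  shows "smooth_on UNIV (\<lambda>x. prd (f x) (g x))"
  using assms by (simp add: smooth_on_def Ck_on_bilinear)

lemmas smooth_on_mult = smooth_on_bilinear[OF bounded_bilinear_mult]

lemma smooth_on_compose:
  fixes g :: "'a::euclidean_space \<Rightarrow> 'b::euclidean_space"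
  shows "smooth_on UNIV f \<Longrightarrow> smooth_on UNIV g \<Longrightarrow> smooth_on UNIV (\<lambda>x. f (g x))"
  unfolding smooth_on_def using Ck_on_compose by blast

lemma smooth_on_linear_compose:
  fixes g :: "'a::euclidean_space \<Rightarrow> 'b::euclidean_space"
  shows "bounded_linear l \<Longrightarrow> smooth_on UNIV g \<Longrightarrow> smooth_on UNIV (\<lambda>x. l (g x))"
  by (rule smooth_on_compose[OF smooth_on_bounded_linear])

lemma smooth_on_diff:
  fixes f g :: "'a::euclidean_space \<Rightarrow> real"
  assumes "smooth_on UNIV f" "smooth_on UNIV g"
  shows "smooth_on UNIV (\<lambda>x. f x - g x)"
  using smooth_on_add[OF assms(1) smooth_on_mult[OF smooth_on_const[of "-1"] assms(2)]]
  by simp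

lemma smooth_on_prod:
  fixes f :: "'i \<Rightarrow> 'a::euclidean_space \<Rightarrow> real"
  shows "(\<And>i. i \<in> I \<Longrightarrow> smooth_on UNIV (f i)) \<Longrightarrow> smooth_on UNIV (\<lambda>x. \<Prod>i\<in>I. f i x)"
  by (induction I rule: infinite_finite_induct) (simp_all add: smooth_on_mult)

lemma smooth_on_Pair:
  fixes f :: "'a::euclidean_space \<Rightarrow> 'b::euclidean_space" and g :: "'a \<Rightarrow> 'c::euclidean_space"
  assumes "smooth_on UNIV f" "smooth_on UNIV g"
  shows "smooth_on UNIV (\<lambda>x. (f x, g x))"
proof -
  have "bounded_linear (\<lambda>y. (y, 0 :: 'c))" "bounded_linear (\<lambda>z. (0 :: 'b, z))"
    by (intro bounded_linear_Pair bounded_linear_ident bounded_linear_zero)+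
  then have "smooth_on UNIV (\<lambda>x. (f x, 0 :: 'c))" "smooth_on UNIV (\<lambda>x. (0 :: 'b, g x))"
    using smooth_on_linear_compose[OF _ assms(1)] smooth_on_linear_compose[OF _ assms(2)] by blast+
  then show ?thesis
    using smooth_on_add[of "\<lambda>x. (f x, 0)" "\<lambda>x. (0, g x)"] by simp
qed

lemma smooth_on_has_derivative:
  "smooth_on UNIV f \<Longrightarrow> (f has_derivative frechet_derivative f (at x)) (at x)"
  unfolding smooth_on_def by (metis Ck_on_SucD(1))

lemma smooth_on_frechet_derivative:
  "smooth_on UNIV f \<Longrightarrow> smooth_on UNIV (\<lambda>x. frechet_derivative f (at x) v)"
  unfolding smooth_on_def by (metis Ck_on_SucD(2))

lemma smooth_on_continuous_on: "smooth_on UNIV f \<Longrightarrow> continuous_on S f"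
  unfolding smooth_on_def by (metis Ck_on.simps(1) continuous_on_subset subset_UNIV)

lemma smooth_on_borel_measurable: "smooth_on UNIV f \<Longrightarrow> f \<in> borel_measurable borel"
  by (intro borel_measurable_continuous_onI smooth_on_continuous_on)

lemma smooth_on_partial: "smooth_on UNIV f \<Longrightarrow> smooth_on UNIV (partial i f)"
  using smooth_on_frechet_derivative[of f "axis i 1"] by (simp add: partial_def[abs_def])

lemma partial_eqI: "(f has_derivative f') (at x) \<Longrightarrow> partial i f x = f' (axis i 1)"
  by (metis frechet_derivative_at partial_def)

section \<open>Flat functions\<close>

text \<open>For \<open>m = 0\<close> this is the classical function exp(-1/t), extended by zero. The
  powers of 1/t make the family closed under differentiation up to linear combinations, so
  smoothness of all members follows by a single induction.\<close>

definition flat :: "nat \<Rightarrow> real \<Rightarrow> real" where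
  "flat m t = (if t > 0 then (1 / t) ^ m * exp (- 1 / t) else 0)"

lemma flat_has_derivative:
  "(flat m has_real_derivative (flat (m + 2) t - m * flat (m + 1) t)) (at t)"
proof -
  consider "t > 0" | "t < 0" | "t = 0" by linarith
  then show ?thesis
  proof cases
    case 1
    have "((\<lambda>t. (1 / t) ^ m * exp (- 1 / t)) has_real_derivative
        (flat (m + 2) t - m * flat (m + 1) t)) (at t)"
      using 1
      by (cases m) (auto intro!: derivative_eq_intros simp: flat_def field_simps power2_eq_square,
          metis power_eq_if One_nat_def)
    then show ?thesis
      by (rule has_field_derivative_transform_within_open[where S="{0<..}"])
         (use 1 in \<open>auto simp: flat_def\<close>)
  next
    case 2
    have "((\<lambda>t. 0) has_real_derivative (flat (m + 2) t - m * flat (m + 1) t)) (at t)"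
      using 2 by (auto simp: flat_def)
    then show ?thesis
      by (rule has_field_derivative_transform_within_open[where S="{..<0}"])
         (use 2 in \<open>auto simp: flat_def\<close>)
  next
    case 3
    \<comment> \<open>With s = 1/h the difference quotient \<open>flat m h / h\<close> at the origin
      becomes s^(m+1) / exp s, which tends to 0 as s tends to infinity.\<close>
    have "((\<lambda>s::real. s ^ Suc m / exp s) \<longlongrightarrow> 0) at_top"
      by (rule tendsto_power_div_exp_0)
    then have "((\<lambda>h. (inverse h) ^ Suc m / exp (inverse h)) \<longlongrightarrow> 0) (at_right (0::real))"
      by (rule filterlim_compose) (rule filterlim_inverse_at_top_right)
    then have r: "((\<lambda>h. flat m h / h) \<longlongrightarrow> 0) (at_right 0)"
      by (rule Lim_transform_eventually)
         (rule eventually_mono[OF eventually_at_right_less[of 0]],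
          simp add: flat_def field_simps exp_minus power_inverse)
    have l: "((\<lambda>h. flat m h / h) \<longlongrightarrow> 0) (at_left 0)"
      by (rule Lim_transform_eventually[OF tendsto_const])
         (simp add: eventually_at_filter flat_def)
    show ?thesis
      using r l 3 by (auto simp: DERIV_def flat_def filterlim_split_at)
  qed
qed

lemma Ck_on_flat: "Ck_on k UNIV (flat m)"
proof (induction k arbitrary: m)
  case 0
  show ?case
    by (auto intro!: continuous_at_imp_continuous_on DERIV_isCont flat_has_derivative)
next
  case (Suc k)
  have "Ck_on k UNIV (\<lambda>t. (flat (m + 2) t + (- real m) * flat (m + 1) t) * v)" for v
    by (intro Ck_on_bilinear[OF bounded_bilinear_mult] Ck_on_const Ck_on_add Suc)
  then show ?case
    by (intro Ck_on_SucI[OF flat_has_derivative[unfolded has_field_derivative_def]]) simp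
qed

lemma smooth_on_exp: "smooth_on UNIV (exp :: real \<Rightarrow> real)"
proof -
  have "Ck_on k UNIV (exp :: real \<Rightarrow> real)" for k
  proof (induction k)
    case (Suc k)
    have "Ck_on k UNIV (\<lambda>x. exp x * v)" for v :: real
      by (intro Ck_on_bilinear[OF bounded_bilinear_mult] Ck_on_const Suc)
    then show ?case
      by (intro Ck_on_SucI[OF DERIV_exp[unfolded has_field_derivative_def]])
  qed (simp add: continuous_on_exp)
  then show ?thesis by (simp add: smooth_on_def)
qed

lemma smooth_on_flat: "smooth_on UNIV (flat m)"
  by (simp add: smooth_on_def Ck_on_flat)

lemma flat_nonneg: "0 \<le> flat m t" and flat_pos_iff: "0 < flat m t \<longleftrightarrow> t > 0"
  by (auto simp: flat_def)

section \<open>Test functions\<close>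

lemma in_supp: "f x \<noteq> 0 \<Longrightarrow> x \<in> supp f"
  unfolding supp_def by (rule closure_subset[THEN subsetD]) simp

lemma test_functions_smooth: "\<phi> \<in> test_functions UNIV \<Longrightarrow> smooth_on UNIV \<phi>"
  and test_functions_compact: "\<phi> \<in> test_functions UNIV \<Longrightarrow> compact (supp \<phi>)"
  by (auto simp: test_functions_def)

lemma test_functionsI:
  assumes "smooth_on UNIV \<phi>" "compact K" "\<And>x. x \<notin> K \<Longrightarrow> \<phi> x = 0"
  shows "\<phi> \<in> test_functions UNIV"
proof -
  have "supp \<phi> \<subseteq> K"
    unfolding supp_def using assms by (intro closure_minimal compact_imp_closed) auto
  then have "compact (supp \<phi>)"
    using assms(2) closed_Int_compact[of "supp \<phi>" K] by (auto simp: supp_def Int_absorb2)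
  then show ?thesis using assms(1) by (simp add: test_functions_def)
qed

text \<open>A product of one-dimensional flat functions, one factor for each face of the
  box.\<close>

lemma ex_smooth_box_bump:
  fixes a b :: "'a::euclidean_space"
  shows "\<exists>\<psi> :: 'a \<Rightarrow> real. smooth_on UNIV \<psi> \<and> (\<forall>x. 0 \<le> \<psi> x) \<and> (\<forall>x. 0 < \<psi> x \<longleftrightarrow> x \<in> box a b)"
proof -
  define \<psi> where "\<psi> x = (\<Prod>i\<in>Basis. flat 0 (x \<bullet> i - a \<bullet> i) * flat 0 (b \<bullet> i - x \<bullet> i))" for x :: 'a
  have sm: "smooth_on UNIV (\<lambda>x::'a. x \<bullet> i)" for i
    by (intro smooth_on_bounded_linear bounded_linear_inner_left)
  have "smooth_on UNIV \<psi>"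
    unfolding \<psi>_def
    by (intro smooth_on_prod smooth_on_mult smooth_on_compose[OF smooth_on_flat] smooth_on_diff
        sm smooth_on_const)
  moreover have nonneg: "0 \<le> \<psi> x" for x
    unfolding \<psi>_def by (intro prod_nonneg ballI mult_nonneg_nonneg flat_nonneg)
  moreover have "0 < \<psi> x \<longleftrightarrow> x \<in> box a b" for x
  proof
    assume "0 < \<psi> x"
    then have "\<psi> x \<noteq> 0" by simp
    then have "\<forall>i\<in>Basis. flat 0 (x \<bullet> i - a \<bullet> i) * flat 0 (b \<bullet> i - x \<bullet> i) \<noteq> 0"
      unfolding \<psi>_def by (subst (asm) prod_zero_iff) auto
    then show "x \<in> box a b"
      by (auto simp: mem_box flat_def split: if_splits)
  next
    assume "x \<in> box a b"
    then show "0 < \<psi> x"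
      unfolding \<psi>_def by (intro prod_pos) (auto simp: mem_box flat_pos_iff)
  qed
  ultimately show ?thesis by blast
qed

lemma ex_test_function_pos:
  fixes x0 :: "'a::euclidean_space"
  shows "\<exists>\<psi>\<in>test_functions UNIV. (\<forall>x. 0 \<le> \<psi> x) \<and> 0 < \<psi> x0"
proof -
  obtain \<psi> :: "'a \<Rightarrow> real" where \<psi>: "smooth_on UNIV \<psi>" "\<And>x. 0 \<le> \<psi> x"
      "\<And>x. 0 < \<psi> x \<longleftrightarrow> x \<in> box (x0 - One) (x0 + One)"
    using ex_smooth_box_bump by metis
  have "\<psi> x = 0" if "x \<notin> cbox (x0 - One) (x0 + One)" for x
    using \<psi>(2)[of x] \<psi>(3)[of x] that box_subset_cbox[of "x0 - One" "x0 + One"]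
    by (auto simp: less_eq_real_def)
  then have "\<psi> \<in> test_functions UNIV"
    using \<psi>(1) by (intro test_functionsI[where K="cbox (x0 - One) (x0 + One)"]) auto
  moreover have "0 < \<psi> x0"
    by (simp add: \<psi>(3) mem_box inner_simps)
  ultimately show ?thesis using \<psi>(2) by blast
qed

text \<open>An open set is a countable union of open boxes. The partial sums \<open>S n\<close> of
  their bumps are zero off \<open>U\<close> and eventually bounded below by a positive number at
  each point of \<open>U\<close>, so \<open>1 - exp (- n * S n)\<close> tends to the indicator.
  Finite sums suffice, and hence no infinite series has to be differentiated.\<close>

lemma ex_test_functions_tendsto_indicator:
  fixes U :: "'a::euclidean_space set"
  assumes "open U" "bounded U"
  obtains \<theta> :: "nat \<Rightarrow> 'a \<Rightarrow> real"
  where "\<And>n. \<theta> n \<in> test_functions UNIV" "\<And>n x. 0 \<le> \<theta> n x" "\<And>n x. \<theta> n x \<le> indicator U x"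
    "\<And>x. (\<lambda>n. \<theta> n x) \<longlonglongrightarrow> indicator U x"
proof -
  obtain \<D> where \<D>: "countable \<D>" "\<And>X. X \<in> \<D> \<Longrightarrow> \<exists>a b. X = box a b" "\<Union>\<D> = U"
    using open_countable_Union_open_box[OF assms(1)] by metis
  \<comment> \<open>The empty box \<open>box 0 0\<close> makes the family nonempty, so that it can
    be enumerated even if \<open>U\<close> is empty.\<close>
  let ?\<D> = "insert (box 0 0) \<D>"
  define B where "B = from_nat_into ?\<D>"
  have rB: "range B = ?\<D>"
    unfolding B_def using \<D>(1) by (intro range_from_nat_into) auto
  have U: "U = (\<Union>n. B n)"
    using \<D>(3) rB by auto
  have "\<exists>\<psi> :: 'a \<Rightarrow> real. smooth_on UNIV \<psi> \<and> (\<forall>x. 0 \<le> \<psi> x) \<and> (\<forall>x. 0 < \<psi> x \<longleftrightarrow> x \<in> B n)" for n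
  proof -
    have "B n \<in> ?\<D>" using rB by blast
    then obtain a b where "B n = box a b" using \<D>(2) by blast
    then show ?thesis using ex_smooth_box_bump by metis
  qed
  then obtain \<psi> :: "nat \<Rightarrow> 'a \<Rightarrow> real" where \<psi>: "\<And>n. smooth_on UNIV (\<psi> n)" "\<And>n x. 0 \<le> \<psi> n x"
      "\<And>n x. 0 < \<psi> n x \<longleftrightarrow> x \<in> B n"
    by metis
  define S where "S n x = (\<Sum>i<n. \<psi> i x)" for n x
  define \<theta> where "\<theta> n x = 1 - exp ((- real n) * S n x)" for n x
  have S0: "0 \<le> S n x" for n x
    unfolding S_def by (intro sum_nonneg \<psi>)
  have S_out: "S n x = 0" if "x \<notin> U" for n x
    unfolding S_def using \<psi>(2,3) that U by (intro sum.neutral ballI) (metis UN_I UNIV_I less_eq_real_def)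
  have le: "\<theta> n x \<le> indicator U x" for n x
    using S_out[of x n] by (cases "x \<in> U") (auto simp: \<theta>_def)
  have nn: "0 \<le> \<theta> n x" for n x
    using S0[of n x] by (simp add: \<theta>_def)
  have sm: "smooth_on UNIV (\<theta> n)" for n
    unfolding \<theta>_def S_def
    by (intro smooth_on_diff smooth_on_const smooth_on_compose[OF smooth_on_exp] smooth_on_mult
        smooth_on_sum \<psi>)
  have "\<theta> n \<in> test_functions UNIV" for n
  proof (rule test_functionsI[OF sm])
    show "compact (closure U)" using assms(2) by simp
    show "\<theta> n x = 0" if "x \<notin> closure U" for x
      using le[of n x] nn[of n x] that closure_subset[of U] by (cases "x \<in> U") auto
  qed
  moreover have "(\<lambda>n. \<theta> n x) \<longlonglongrightarrow> indicator U x" for x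
  proof (cases "x \<in> U")
    case True
    then obtain m where m: "x \<in> B m" using U by blast
    have ev: "\<forall>\<^sub>F n in sequentially. norm (exp ((- real n) * S n x)) \<le> exp (- \<psi> m x * real n)"
      using eventually_gt_at_top[of m]
    proof eventually_elim
      case (elim n)
      have "\<psi> m x \<le> S n x"
        unfolding S_def using elim by (intro member_le_sum) (auto intro: \<psi>)
      then show ?case by (simp add: mult.commute mult_left_mono)
    qed
    have "0 < \<psi> m x" using m \<psi>(3) by blast
    then have "(\<lambda>n. exp (- \<psi> m x * real n)) \<longlonglongrightarrow> 0"
      by real_asymp
    then have "(\<lambda>n. exp ((- real n) * S n x)) \<longlonglongrightarrow> 0"
      by (rule Lim_null_comparison[OF ev])
    from tendsto_diff[OF tendsto_const this, of 1] show ?thesis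
      using True by (simp add: \<theta>_def)
  next
    case False
    then show ?thesis using S_out by (simp add: \<theta>_def)
  qed
  ultimately show thesis using that nn le by blast
qed

section \<open>Local integrability and the fundamental lemma of the calculus of variations\<close>

text \<open>The Borel counterpart of \<open>L1_loc\<close>: with Borel functions and
  \<open>lborel\<close>, Fubini's theorem and images under translations apply directly.\<close>

definition loc_integrable :: "('a::euclidean_space \<Rightarrow> real) \<Rightarrow> bool" where
  "loc_integrable u \<longleftrightarrow>
     u \<in> borel_measurable borel \<and> (\<forall>K. compact K \<longrightarrow> set_integrable lborel K u)"

lemma loc_integrable_measurable: "loc_integrable u \<Longrightarrow> u \<in> borel_measurable borel"
  by (simp add: loc_integrable_def)

lemma loc_integrable_mult:
  assumes u: "loc_integrable u" and h: "h \<in> borel_measurable borel" "\<And>x. \<bar>h x\<bar> \<le> C"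
    and K: "compact K" "\<And>x. x \<notin> K \<Longrightarrow> h x = 0"
  shows "integrable lborel (\<lambda>x. u x * h x)"
proof (rule Bochner_Integration.integrable_bound)
  show "integrable lborel (\<lambda>x. C * (indicator K x *\<^sub>R u x))"
    using u K(1) by (auto simp: loc_integrable_def set_integrable_def)
  show "(\<lambda>x. u x * h x) \<in> borel_measurable lborel"
    using loc_integrable_measurable[OF u] h(1) by simp
  have "\<bar>u x\<bar> * \<bar>h x\<bar> \<le> \<bar>C\<bar> * \<bar>u x\<bar>" for x
    using h(2)[of x] by (metis abs_ge_self abs_ge_zero mult.commute mult_left_mono order_trans)
  then show "AE x in lborel. norm (u x * h x) \<le> norm (C * (indicator K x *\<^sub>R u x))"
    using K(2) by (auto simp: abs_mult indicator_def)
qed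

lemma loc_integrable_continuous:
  assumes "continuous_on UNIV u"
  shows "loc_integrable u"
proof -
  have "set_integrable lborel K u" if "compact K" for K
    using that assms by (metis borel_integrable_compact continuous_on_subset set_integrable_def subset_UNIV
      mult.commute real_scaleR_def)
  then show ?thesis
    using assms by (auto simp: loc_integrable_def intro: borel_measurable_continuous_onI)
qed

lemma continuous_compact_bounded:
  fixes h :: "'a::euclidean_space \<Rightarrow> real"
  assumes "continuous_on UNIV h" "compact K" "\<And>x. x \<notin> K \<Longrightarrow> h x = 0"
  obtains C where "0 \<le> C" "\<And>x. \<bar>h x\<bar> \<le> C"
proof -
  have "bounded (h ` K)"
    using assms by (intro compact_imp_bounded compact_continuous_image continuous_on_subset[OF assms(1)]) auto
  then obtain C where "C > 0" "\<And>x. x \<in> K \<Longrightarrow> \<bar>h x\<bar> \<le> C"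
    by (auto simp: bounded_pos)
  then show thesis
    using that[of C] assms(3) by (metis abs_zero less_imp_le)
qed

lemma loc_integrable_mult_continuous:
  assumes "loc_integrable u" "continuous_on UNIV h" "compact K" "\<And>x. x \<notin> K \<Longrightarrow> h x = 0"
  shows "integrable lborel (\<lambda>x. u x * h x)"
proof -
  obtain C where "\<And>x. \<bar>h x\<bar> \<le> C"
    using continuous_compact_bounded assms(2-4) by metis
  then show ?thesis
    using assms by (intro loc_integrable_mult) (auto intro: borel_measurable_continuous_onI)
qed

lemma loc_integrable_mult_test:
  assumes "loc_integrable u" "\<phi> \<in> test_functions UNIV"
  shows "integrable lborel (\<lambda>x. u x * \<phi> x)"
  using assms in_supp[of \<phi>]
  by (intro loc_integrable_mult_continuous[where K="supp \<phi>"])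
     (auto intro: smooth_on_continuous_on test_functions_smooth test_functions_compact)

text \<open>The inequality passes from test functions to indicators of bounded open sets, then to
  bounded countable intersections of open sets, and so, up to a null set, to the part of
  \<open>{u > 0}\<close> in a ball. There the integrand is nonnegative with nonpositive
  integral.\<close>

lemma AE_nonpos_of_test_functions:
  fixes u :: "'a::euclidean_space \<Rightarrow> real"
  assumes u: "loc_integrable u"
    and le: "\<And>\<phi>. \<phi> \<in> test_functions UNIV \<Longrightarrow> (\<And>x. 0 \<le> \<phi> x) \<Longrightarrow> (\<integral>x. u x * \<phi> x \<partial>lborel) \<le> 0"
  shows "AE x in lborel. u x \<le> 0"
proof -
  have [measurable]: "u \<in> borel_measurable borel"
    using u by (rule loc_integrable_measurable)
  have int: "integrable lborel (\<lambda>x. u x * indicator E x)" if "E \<in> sets borel" "bounded E" for E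
    using that closure_subset[of E]
    by (intro loc_integrable_mult[OF u, where C=1 and K="closure E"]) (auto simp: indicator_def)
  have open_le: "(\<integral>x. u x * indicator U x \<partial>lborel) \<le> 0" if U: "open U" "bounded U" for U
  proof -
    obtain \<theta> :: "nat \<Rightarrow> 'a \<Rightarrow> real"
      where \<theta>: "\<And>n. \<theta> n \<in> test_functions UNIV" "\<And>n x. 0 \<le> \<theta> n x"
        "\<And>n x. \<theta> n x \<le> indicator U x" "\<And>x. (\<lambda>n. \<theta> n x) \<longlonglongrightarrow> indicator U x"
      using ex_test_functions_tendsto_indicator[OF U] by metis
    have m [measurable]: "\<theta> n \<in> borel_measurable borel" for n
      using \<theta>(1) by (intro smooth_on_borel_measurable test_functions_smooth)
    have "(\<lambda>n. \<integral>x. u x * \<theta> n x \<partial>lborel) \<longlonglongrightarrow> (\<integral>x. u x * indicator U x \<partial>lborel)"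
    proof (rule integral_dominated_convergence)
      show "integrable lborel (\<lambda>x. \<bar>u x * indicator U x\<bar>)"
        using int U by (intro integrable_abs) auto
      show "AE x in lborel. norm (u x * \<theta> n x) \<le> \<bar>u x * indicator U x\<bar>" for n
        using \<theta>(2,3)[of n] by (auto simp: abs_mult intro!: AE_I2 mult_left_mono)
      show "AE x in lborel. (\<lambda>n. u x * \<theta> n x) \<longlonglongrightarrow> u x * indicator U x"
        by (intro AE_I2 tendsto_mult_left \<theta>)
    qed (use U in auto)
    then show ?thesis
      using le[OF \<theta>(1) \<theta>(2)] by (intro LIMSEQ_le_const2) auto
  qed
  have "AE x in lborel. x \<in> ball 0 r \<longrightarrow> u x \<le> 0" for r
  proof -
    define E where "E = {x \<in> ball 0 r. u x > 0}"
    have E [measurable]: "E \<in> sets borel"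
      unfolding E_def by measurable
    \<comment> \<open>Outer regularity: \<open>E\<close> differs from a countable intersection of
      open sets only by a null set.\<close>
    then obtain C T where CT: "gdelta C" "T \<in> null_sets lebesgue" "E \<union> T = C"
      using lebesgue_set_almost_gdelta[of E] by (metis sets_completionI_sets sets_lborel)
    obtain W where W: "\<And>n::nat. open (W n)" "C = (\<Inter>n. W n)"
      using CT(1) by (auto elim!: gdelta.cases)
    \<comment> \<open>Bounded open sets decreasing to \<open>ball 0 r \<inter> C\<close>; the ball
      supplies the integrable majorant for dominated convergence.\<close>
    define V where "V n = ball 0 r \<inter> (\<Inter>i\<le>n. W i)" for n
    have V: "open (V n)" "bounded (V n)" for n
      unfolding V_def using W by (auto intro!: open_INT bounded_subset[OF bounded_ball, of _ 0 r])
    have C [measurable]: "C \<in> sets borel"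
      unfolding W(2) using W(1) by (intro sets.countable_INT) auto
    have D: "ball 0 r \<inter> C \<in> sets borel" "bounded (ball 0 r \<inter> C)"
      by (auto intro: bounded_subset[OF bounded_ball, of _ 0 r])
    note D(1) [measurable]
    have "(\<lambda>n. \<integral>x. u x * indicator (V n) x \<partial>lborel) \<longlonglongrightarrow>
        (\<integral>x. u x * indicator (ball 0 r \<inter> C) x \<partial>lborel)"
    proof (rule integral_dominated_convergence)
      show "integrable lborel (\<lambda>x. \<bar>u x * indicator (ball 0 r) x\<bar>)"
        using int by (intro integrable_abs) auto
      show "AE x in lborel. norm (u x * indicator (V n) x) \<le> \<bar>u x * indicator (ball 0 r) x\<bar>" for n
        by (auto simp: V_def indicator_def)
      show "AE x in lborel. (\<lambda>n. u x * indicator (V n) x) \<longlonglongrightarrow> u x * indicator (ball 0 r \<inter> C) x"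
      proof (intro AE_I2 tendsto_mult_left)
        fix x :: 'a
        show "(\<lambda>n. indicator (V n) x :: real) \<longlonglongrightarrow> indicator (ball 0 r \<inter> C) x"
        proof (cases "x \<in> ball 0 r \<inter> C")
          case True
          then show ?thesis by (simp add: V_def W(2) indicator_def)
        next
          case False
          then have "\<exists>m. \<forall>n\<ge>m. x \<notin> V n"
            by (cases "x \<in> ball 0 r") (auto simp: V_def W(2))
          then have "\<forall>\<^sub>F n in sequentially. indicator (ball 0 r \<inter> C) x = (indicator (V n) x :: real)"
            unfolding eventually_sequentially using False by (auto simp: indicator_def)
          then show ?thesis by (rule tendsto_eventually[OF eventually_mono]) simp
        qed
      qed
    qed (use V D in auto)
    then have "(\<integral>x. u x * indicator (ball 0 r \<inter> C) x \<partial>lborel) \<le> 0"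
      using open_le[OF V] by (intro LIMSEQ_le_const2) auto
    also have "(\<integral>x. u x * indicator (ball 0 r \<inter> C) x \<partial>lborel) = (\<integral>x. u x * indicator E x \<partial>lborel)"
    proof (rule integral_cong_AE)
      have "AE x in lebesgue. x \<notin> T"
        using CT(2) by (rule AE_not_in)
      then have "AE x in lborel. x \<notin> T"
        by (simp add: AE_completion_iff)
      then show "AE x in lborel. u x * indicator (ball 0 r \<inter> C) x = u x * indicator E x"
        by (rule eventually_mono) (use CT(3) in \<open>auto simp: indicator_def E_def\<close>)
    qed auto
    finally have le0: "(\<integral>x. u x * indicator E x \<partial>lborel) \<le> 0" .
    have nn: "AE x in lborel. 0 \<le> u x * indicator E x"
      by (auto simp: E_def indicator_def)
    moreover have iE: "integrable lborel (\<lambda>x. u x * indicator E x)"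
      by (rule int[OF E]) (auto simp: E_def intro: bounded_subset[OF bounded_ball, of _ 0 r])
    ultimately have "AE x in lborel. u x * indicator E x = 0"
      using le0 integral_nonneg_AE[OF nn] integral_nonneg_eq_0_iff_AE[OF iE nn] by linarith
    then show ?thesis
      by eventually_elim (auto simp: E_def indicator_def split: if_splits)
  qed
  then have "AE x in lborel. \<forall>n::nat. x \<in> ball 0 (real n) \<longrightarrow> u x \<le> 0"
    unfolding AE_all_countable by blast
  then show ?thesis
  proof eventually_elim
    case (elim x)
    obtain n :: nat where "norm x < real n"
      using reals_Archimedean2 by blast
    then show ?case using elim by auto
  qed
qed

lemma AE_eq_0_of_test_functions:
  fixes u :: "'a::euclidean_space \<Rightarrow> real"
  assumes u: "loc_integrable u"
    and eq: "\<And>\<phi>. \<phi> \<in> test_functions UNIV \<Longrightarrow> (\<integral>x. u x * \<phi> x \<partial>lborel) = 0"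
  shows "AE x in lborel. u x = 0"
proof -
  have "loc_integrable (\<lambda>x. - u x)"
    using u by (auto simp: loc_integrable_def set_integrable_def)
  then have "AE x in lborel. - u x \<le> 0"
    using eq by (intro AE_nonpos_of_test_functions) auto
  moreover have "AE x in lborel. u x \<le> 0"
    using eq u by (intro AE_nonpos_of_test_functions) auto
  ultimately show ?thesis by eventually_elim simp
qed

lemma AE_lborel_ex_in_open:
  fixes U :: "'a::euclidean_space set"
  assumes "AE x in lborel. P x" "open U" "U \<noteq> {}"
  shows "\<exists>x\<in>U. P x"
proof (rule ccontr)
  assume none: "\<not> ?thesis"
  from assms(1) have "AE x in lborel. x \<notin> U"
    by (rule eventually_mono) (use none in blast)
  then have "U \<in> null_sets lborel"
    using assms(2) by (subst AE_iff_null_sets) auto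
  then show False
    using assms(2,3) emeasure_lborel_countable open_not_negligible[of U]
    by (auto simp: negligible_iff_null_sets null_sets_completionI)
qed

text \<open>The preimage of the complement of \<open>C\<close> is open, and a nonempty open set is
  not null. This upgrades almost everywhere statements about continuous functions to pointwise
  ones.\<close>

lemma AE_closed_imp_all:
  fixes f :: "'a::euclidean_space \<Rightarrow> 'b::t1_space"
  assumes "AE x in lborel. f x \<in> C" "continuous_on UNIV f" "closed C"
  shows "f x \<in> C"
proof -
  have "open (f -` (- C))"
    using assms by (intro open_vimage) auto
  then show ?thesis
    using AE_lborel_ex_in_open[OF assms(1), of "f -` (- C)"] by blast
qed

section \<open>Integration by parts\<close>

lemma
  fixes f :: "'a::euclidean_space \<Rightarrow> 'b::{banach, second_countable_topology}"
  assumes "f \<in> borel_measurable borel"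
  shows integral_lborel_translate: "(\<integral>x. f (c + x) \<partial>lborel) = integral\<^sup>L lborel f"
    and integrable_lborel_translate: "integrable lborel f \<Longrightarrow> integrable lborel (\<lambda>x. f (c + x))"
proof -
  have m: "(+) c \<in> measurable lborel borel" by simp
  show "(\<integral>x. f (c + x) \<partial>lborel) = integral\<^sup>L lborel f"
    using integral_distr[OF m assms] by (simp add: lborel_distr_plus)
  show "integrable lborel f \<Longrightarrow> integrable lborel (\<lambda>x. f (c + x))"
    using integrable_distr[OF m, of f] by (simp add: lborel_distr_plus)
qed

lemma partial_eq_0_outside:
  assumes "closed K" "\<And>x. x \<notin> K \<Longrightarrow> f x = 0" "x \<notin> K"
  shows "partial i f x = 0"
proof -
  have "(f has_derivative (\<lambda>v. 0)) (at x)"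
    using assms by (intro has_derivative_transform_within_open[OF has_derivative_const, where s="- K"]) auto
  then show ?thesis by (simp add: partial_eqI)
qed

lemma smooth_on_has_partial:
  assumes "smooth_on UNIV g"
  shows "((\<lambda>t. g (x + t *\<^sub>R axis i 1)) has_real_derivative partial i g (x + t *\<^sub>R axis i 1)) (at t)"
proof -
  let ?D = "frechet_derivative g (at (x + t *\<^sub>R axis i 1))"
  have D: "(g has_derivative ?D) (at (x + t *\<^sub>R axis i 1))"
    by (rule smooth_on_has_derivative[OF assms])
  have "((\<lambda>t. x + t *\<^sub>R axis i 1) has_derivative (\<lambda>s. s *\<^sub>R axis i 1)) (at t)"
    by (auto intro!: derivative_eq_intros)
  from has_derivative_compose[OF this D]
  have "((\<lambda>t. g (x + t *\<^sub>R axis i 1)) has_derivative (\<lambda>s. ?D (s *\<^sub>R axis i 1))) (at t)" .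
  moreover have "?D (s *\<^sub>R axis i 1) = partial i g (x + t *\<^sub>R axis i 1) * s" for s
    using linear_cmul[OF has_derivative_linear[OF D]] by (simp add: partial_def)
  ultimately show ?thesis by (simp add: has_field_derivative_def)
qed

text \<open>Translation invariance of Lebesgue measure makes the integral of every difference
  quotient zero; dominated convergence passes this on to the derivative.\<close>

lemma integral_partial_eq_0:
  fixes g :: "real^'n \<Rightarrow> real"
  assumes g: "smooth_on UNIV g" and K: "compact K" "\<And>x. x \<notin> K \<Longrightarrow> g x = 0"
  shows "(\<integral>x. partial i g x \<partial>lborel) = 0"
proof -
  let ?e = "axis i 1 :: real^'n"
  let ?h = "\<lambda>n. inverse (real (Suc n))"
  define s where "s n x = real (Suc n) * (g (?h n *\<^sub>R ?e + x) - g x)" for n x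
  obtain C where C: "0 \<le> C" "\<And>x. \<bar>partial i g x\<bar> \<le> C"
    using continuous_compact_bounded[of "partial i g", OF smooth_on_continuous_on[OF smooth_on_partial[OF g]] K(1)
          partial_eq_0_outside[OF compact_imp_closed[OF K(1)] K(2)]] by blast
  \<comment> \<open>\<open>K\<close> swept backwards along the \<open>i\<close>-th axis over the
    distances in [0, 1]. The steps \<open>?h n\<close> are at most 1, so this compact set carries
    all the quotients \<open>s n\<close>.\<close>
  define K' where "K' = (\<lambda>(x, t). x - t *\<^sub>R ?e) ` (K \<times> {0..1})"
  have "compact K'"
    unfolding K'_def
    by (intro compact_continuous_image compact_Times K compact_Icc) (auto intro!: continuous_intros simp: case_prod_unfold)
  then have [measurable]: "K' \<in> sets borel" and fin: "emeasure lborel K' < \<infinity>"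
    using emeasure_bounded_finite[OF compact_imp_bounded] by (auto intro: borel_compact)
  have gm [measurable]: "g \<in> borel_measurable borel"
    using g by (rule smooth_on_borel_measurable)
  have int: "integrable lborel g"
    using loc_integrable_mult_continuous[OF loc_integrable_continuous[of "\<lambda>x. 1"] smooth_on_continuous_on[OF g] K]
    by simp
  \<comment> \<open>By the mean value theorem a difference quotient is a value of the partial
    derivative, hence bounded by \<open>C\<close>.\<close>
  have bd: "norm (s n x) \<le> C * indicator K' x" for n x
  proof (cases "x \<in> K'")
    case True
    have "\<exists>t. 0 < t \<and> t < ?h n \<and> g (x + ?h n *\<^sub>R ?e) - g (x + 0 *\<^sub>R ?e) =
        (?h n - 0) * partial i g (x + t *\<^sub>R ?e)"
      by (rule MVT2) (auto intro: smooth_on_has_partial[OF g])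
    then obtain t where "g (?h n *\<^sub>R ?e + x) - g x = ?h n * partial i g (x + t *\<^sub>R ?e)"
      by (auto simp: add.commute)
    then have "s n x = partial i g (x + t *\<^sub>R ?e)"
      by (simp add: s_def)
    then show ?thesis using C(2) True by simp
  next
    case False
    have "x + t *\<^sub>R ?e \<notin> K" if "t \<in> {0..1}" for t
    proof
      assume "x + t *\<^sub>R ?e \<in> K"
      then have "(\<lambda>(x, t). x - t *\<^sub>R ?e) (x + t *\<^sub>R ?e, t) \<in> K'"
        unfolding K'_def using that by blast
      then show False using False by simp
    qed
    from this[of 0] this[of "?h n"] show ?thesis
      using K(2) False by (simp add: s_def add.commute inverse_le_1_iff)
  qed
  have "(\<lambda>n. \<integral>x. s n x \<partial>lborel) \<longlonglongrightarrow> (\<integral>x. partial i g x \<partial>lborel)"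
  proof (rule integral_dominated_convergence)
    show "partial i g \<in> borel_measurable lborel"
      using smooth_on_borel_measurable[OF smooth_on_partial[OF g]] by simp
    show "s n \<in> borel_measurable lborel" for n
      unfolding s_def by measurable
    show "integrable lborel (\<lambda>x. C * indicator K' x)"
      using fin by (intro integrable_mult_right integrable_real_indicator) auto
    show "AE x in lborel. norm (s n x) \<le> C * indicator K' x" for n
      using bd by simp
    show "AE x in lborel. (\<lambda>n. s n x) \<longlonglongrightarrow> partial i g x"
    proof (rule AE_I2)
      fix x
      have "((\<lambda>t. (g (x + t *\<^sub>R ?e) - g x) / t) \<longlongrightarrow> partial i g x) (at 0)"
        using smooth_on_has_partial[OF g, of x i 0] by (simp add: DERIV_def)
      moreover have "filterlim ?h (at 0) sequentially"
        using LIMSEQ_inverse_real_of_nat by (simp add: filterlim_at)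
      ultimately have "(\<lambda>n. (g (x + ?h n *\<^sub>R ?e) - g x) / ?h n) \<longlonglongrightarrow> partial i g x"
        by (rule filterlim_compose)
      then show "(\<lambda>n. s n x) \<longlonglongrightarrow> partial i g x"
        by (simp add: s_def field_simps add.commute)
    qed
  qed
  moreover have "(\<integral>x. s n x \<partial>lborel) = 0" for n
    unfolding s_def
    using integral_lborel_translate[OF gm] integrable_lborel_translate[OF gm int] int by simp
  ultimately show ?thesis
    by (simp add: LIMSEQ_const_iff)
qed

section \<open>The operator and its adjoint\<close>

lemma partial_const [simp]: "partial i (\<lambda>x. c) x = 0"
  by (subst partial_eqI[OF has_derivative_const]) simp

lemma partial_mult:
  assumes "smooth_on UNIV f" "smooth_on UNIV g"
  shows "partial i (\<lambda>x. f x * g x) x = f x * partial i g x + partial i f x * g x"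
  by (subst partial_eqI[OF has_derivative_mult[OF smooth_on_has_derivative smooth_on_has_derivative]])
     (use assms in \<open>auto simp: partial_def\<close>)

lemma partial_add:
  assumes "smooth_on UNIV f" "smooth_on UNIV g"
  shows "partial i (\<lambda>x. f x + g x) x = partial i f x + partial i g x"
  by (subst partial_eqI[OF has_derivative_add[OF smooth_on_has_derivative smooth_on_has_derivative]])
     (use assms in \<open>auto simp: partial_def\<close>)

lemma partial_diff:
  assumes "smooth_on UNIV f" "smooth_on UNIV g"
  shows "partial i (\<lambda>x. f x - g x) x = partial i f x - partial i g x"
  by (subst partial_eqI[OF has_derivative_diff[OF smooth_on_has_derivative smooth_on_has_derivative]])
     (use assms in \<open>auto simp: partial_def\<close>)

lemma partial_compose:
  assumes "smooth_on UNIV g" "(H has_real_derivative d) (at (g x))"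
  shows "partial i (\<lambda>x. H (g x)) x = d * partial i g x"
  by (subst partial_eqI[OF has_derivative_compose[OF smooth_on_has_derivative[OF assms(1)]
        assms(2)[unfolded has_field_derivative_def]]])
     (simp add: partial_def)

lemma smooth_on_divergence:
  "(\<And>i. smooth_on UNIV (\<lambda>x. F x $ i)) \<Longrightarrow> smooth_on UNIV (divergence F)"
  unfolding divergence_def[abs_def] by (intro smooth_on_sum smooth_on_partial)

locale smooth_operator =
  fixes A :: "real^'n \<Rightarrow> real^'n^'n::finite" and b :: "real^'n \<Rightarrow> real^'n"
  assumes A_smooth: "\<And>i j. smooth_on UNIV (\<lambda>x. A x $ i $ j)"
    and b_smooth: "\<And>j. smooth_on UNIV (\<lambda>x. b x $ j)"
    and A_symmetric: "\<And>x. transpose (A x) = A x"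
begin

lemma smooth_on_flux:
  assumes "smooth_on UNIV w"
  shows "smooth_on UNIV (\<lambda>x. (A x *v grad w x) $ i)"
  unfolding matrix_vector_mult_def grad_def vec_lambda_beta
  by (intro smooth_on_sum smooth_on_mult A_smooth smooth_on_partial assms)

lemma smooth_on_diff_op:
  assumes "smooth_on UNIV w"
  shows "smooth_on UNIV (diff_op A b w)"
proof -
  have "smooth_on UNIV (\<lambda>x. divergence (\<lambda>y. A y *v grad w y) x + (\<Sum>i\<in>UNIV. b x $ i * partial i w x))"
    by (intro smooth_on_add smooth_on_divergence smooth_on_flux smooth_on_sum smooth_on_mult
        b_smooth smooth_on_partial assms)
  then show ?thesis
    by (simp add: diff_op_def[abs_def] inner_vec_def grad_def)
qed

lemma smooth_on_adjoint_op:
  assumes "smooth_on UNIV w"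
  shows "smooth_on UNIV (adjoint_op A b w)"
proof -
  have "smooth_on UNIV (\<lambda>x. (w x *\<^sub>R b x) $ i)" for i
    using smooth_on_mult[OF assms b_smooth[of i]] by simp
  then show ?thesis
    unfolding adjoint_op_def[abs_def]
    by (intro smooth_on_diff smooth_on_divergence smooth_on_flux assms)
qed

lemma adjoint_op_eq_0_outside:
  assumes K: "closed K" "\<And>x. x \<notin> K \<Longrightarrow> \<psi> x = 0" "x \<notin> K"
  shows "adjoint_op A b \<psi> x = 0"
proof -
  have "(A y *v grad \<psi> y) $ i = 0" if "y \<notin> K" for y i
    using partial_eq_0_outside[OF K(1,2) that] by (simp add: matrix_vector_mult_def grad_def)
  then have "partial i (\<lambda>y. (A y *v grad \<psi> y) $ i) x = 0" for i
    by (intro partial_eq_0_outside[OF K(1) _ K(3)])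
  moreover have "partial i (\<lambda>y. (\<psi> y *\<^sub>R b y) $ i) x = 0" for i
    by (intro partial_eq_0_outside[OF K(1) _ K(3)]) (simp add: K(2))
  ultimately show ?thesis
    by (simp add: adjoint_op_def divergence_def)
qed

lemma adjoint_op_test:
  assumes "\<psi> \<in> test_functions UNIV"
  shows "adjoint_op A b \<psi> \<in> test_functions UNIV"
proof (rule test_functionsI)
  show "compact (supp \<psi>)" using assms by (rule test_functions_compact)
  show "adjoint_op A b \<psi> x = 0" if "x \<notin> supp \<psi>" for x
    using that in_supp[of \<psi>] by (intro adjoint_op_eq_0_outside[where K="supp \<psi>"]) (auto simp: supp_def)
qed (intro smooth_on_adjoint_op test_functions_smooth assms)

lemma diff_op_const: "diff_op A b (\<lambda>x. c) x = 0"
proof -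
  have "grad (\<lambda>x :: real^'n. c) y = 0" for y
    by (simp add: grad_def vec_eq_iff)
  then show ?thesis
    by (simp add: diff_op_def divergence_def)
qed

text \<open>The flux of \<open>H (g x)\<close> is \<open>H' (g x)\<close> times the flux of
  \<open>g\<close>, and the product rule applied to it creates the quadratic form. For convex
  \<open>H\<close> and nonnegative \<open>A\<close> that extra term has a sign, which is how
  convexity enters the proof.\<close>

lemma diff_op_compose:
  assumes g: "smooth_on UNIV g" and H': "smooth_on UNIV H'"
    and D: "\<And>t. (H has_real_derivative H' t) (at t)" "\<And>t. (H' has_real_derivative H'' t) (at t)"
  shows "diff_op A b (\<lambda>x. H (g x)) x =
    H' (g x) * diff_op A b g x + H'' (g x) * ((A x *v grad g x) \<bullet> grad g x)"
proof -
  have gr: "grad (\<lambda>x. H (g x)) y = H' (g y) *\<^sub>R grad g y" for y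
    by (simp add: grad_def vec_eq_iff partial_compose[OF g D(1)])
  have "partial i (\<lambda>y. H' (g y) * (A y *v grad g y) $ i) x =
      H' (g x) * partial i (\<lambda>y. (A y *v grad g y) $ i) x + H'' (g x) * ((A x *v grad g x) $ i * grad g x $ i)" for i
    by (subst partial_mult[OF smooth_on_compose[OF H' g] smooth_on_flux[OF g]])
       (simp add: partial_compose[OF g D(2)] grad_def)
  then show ?thesis
    by (simp add: diff_op_def divergence_def gr matrix_vector_mult_scaleR sum.distrib
        sum_distrib_left inner_vec_def algebra_simps)
qed

text \<open>Green's identity before integration: the difference of the two products is the
  divergence of an explicit vector field.\<close>

lemma diff_op_adjoint_op_divergence:
  assumes w: "smooth_on UNIV w" and \<psi>: "smooth_on UNIV \<psi>"
  shows "diff_op A b w x * \<psi> x - w x * adjoint_op A b \<psi> x =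
    (\<Sum>i\<in>UNIV. partial i (\<lambda>y. \<psi> y * (A y *v grad w y) $ i - w y * (A y *v grad \<psi> y) $ i
       + w y * (\<psi> y *\<^sub>R b y) $ i) x)" (is "_ = (\<Sum>i\<in>UNIV. ?p i)")
proof -
  let ?Aw = "\<lambda>y. A y *v grad w y" and ?A\<psi> = "\<lambda>y. A y *v grad \<psi> y"
  have sb: "smooth_on UNIV (\<lambda>y. (\<psi> y *\<^sub>R b y) $ i)" for i
    using smooth_on_mult[OF \<psi> b_smooth[of i]] by simp
  have p: "?p i = \<psi> x * partial i (\<lambda>y. ?Aw y $ i) x + grad \<psi> x $ i * ?Aw x $ i
      - (w x * partial i (\<lambda>y. ?A\<psi> y $ i) x + grad w x $ i * ?A\<psi> x $ i)
      + (w x * partial i (\<lambda>y. (\<psi> y *\<^sub>R b y) $ i) x + grad w x $ i * (\<psi> x * b x $ i))" for i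
    by (subst partial_add partial_diff partial_mult;
        (intro smooth_on_diff smooth_on_mult w \<psi> sb smooth_on_flux)?)+
       (simp add: grad_def)
  \<comment> \<open>By symmetry of \<open>A\<close>, the cross terms in the two gradients
    cancel.\<close>
  have sym: "?Aw x \<bullet> grad \<psi> x = ?A\<psi> x \<bullet> grad w x"
    by (metis A_symmetric dot_lmul_matrix inner_commute transpose_matrix_vector)
  have "(\<Sum>i\<in>UNIV. ?p i) = \<psi> x * divergence ?Aw x + ?Aw x \<bullet> grad \<psi> x
      - (w x * divergence ?A\<psi> x + ?A\<psi> x \<bullet> grad w x)
      + (w x * divergence (\<lambda>y. \<psi> y *\<^sub>R b y) x + \<psi> x * (b x \<bullet> grad w x))"
    unfolding p by (simp add: divergence_def inner_vec_def sum.distrib sum_subtractf sum_distrib_left mult_ac)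
  then show ?thesis
    using sym by (simp add: diff_op_def adjoint_op_def algebra_simps)
qed

text \<open>The vector field in Green's identity vanishes off \<open>supp \<psi>\<close>, so the
  integral of its divergence is zero.\<close>

lemma integral_diff_op_adjoint_op:
  assumes w: "smooth_on UNIV w" and \<psi>: "\<psi> \<in> test_functions UNIV"
  shows "(\<integral>x. w x * adjoint_op A b \<psi> x \<partial>lborel) = (\<integral>x. diff_op A b w x * \<psi> x \<partial>lborel)"
proof -
  note s\<psi> = test_functions_smooth[OF \<psi>]
  let ?V = "\<lambda>i y. \<psi> y * (A y *v grad w y) $ i - w y * (A y *v grad \<psi> y) $ i + w y * (\<psi> y *\<^sub>R b y) $ i"
  have sb: "smooth_on UNIV (\<lambda>y. (\<psi> y *\<^sub>R b y) $ i)" for i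
    using smooth_on_mult[OF s\<psi> b_smooth[of i]] by simp
  have sV: "smooth_on UNIV (?V i)" for i
    by (intro smooth_on_add smooth_on_diff smooth_on_mult w s\<psi> sb smooth_on_flux)
  have \<psi>0: "\<psi> x = 0" if "x \<notin> supp \<psi>" for x
    using that in_supp by metis
  have \<psi>1: "partial i \<psi> x = 0" if "x \<notin> supp \<psi>" for x i
    by (rule partial_eq_0_outside[OF compact_imp_closed[OF test_functions_compact[OF \<psi>]] \<psi>0 that])
  have V0: "?V i x = 0" if "x \<notin> supp \<psi>" for i x
    using \<psi>0[OF that] \<psi>1[OF that] by (simp add: matrix_vector_mult_def grad_def)
  have i1: "integrable lborel (\<lambda>x. w x * adjoint_op A b \<psi> x)"
    by (intro loc_integrable_mult_test loc_integrable_continuous smooth_on_continuous_on w adjoint_op_test \<psi>)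
  have i2: "integrable lborel (\<lambda>x. diff_op A b w x * \<psi> x)"
    by (intro loc_integrable_mult_test loc_integrable_continuous smooth_on_continuous_on smooth_on_diff_op w \<psi>)
  have ip: "integrable lborel (\<lambda>x. partial i (?V i) x)" for i
    using loc_integrable_mult_continuous[OF loc_integrable_continuous[of "\<lambda>x. 1"]
        smooth_on_continuous_on[OF smooth_on_partial[OF sV]] test_functions_compact[OF \<psi>]]
      partial_eq_0_outside[OF compact_imp_closed[OF test_functions_compact[OF \<psi>]] V0]
    by simp
  have "(\<integral>x. diff_op A b w x * \<psi> x \<partial>lborel) - (\<integral>x. w x * adjoint_op A b \<psi> x \<partial>lborel)
      = (\<integral>x. (\<Sum>i\<in>UNIV. partial i (?V i) x) \<partial>lborel)"
    by (subst Bochner_Integration.integral_diff[OF i2 i1, symmetric])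
       (simp add: diff_op_adjoint_op_divergence[OF w s\<psi>])
  also have "\<dots> = (\<Sum>i\<in>UNIV. \<integral>x. partial i (?V i) x \<partial>lborel)"
    by (intro Bochner_Integration.integral_sum ip)
  also have "\<dots> = 0"
    using integral_partial_eq_0[OF sV test_functions_compact[OF \<psi>] V0] by simp
  finally show ?thesis by simp
qed

end

section \<open>Differentiation of parameter integrals\<close>

text \<open>All derivatives fall on the smooth kernel \<open>H\<close>, while \<open>u\<close> is
  only locally integrable. Uniform continuity of the derivative of \<open>H\<close> on a compact set
  bounds the remainder of the linearization uniformly in \<open>y\<close>, and this bound is
  integrated against \<open>\<bar>u\<bar>\<close> over \<open>K\<close>.\<close>

lemma has_derivative_parameter_integral:
  fixes H :: "'a::euclidean_space \<times> 'b::euclidean_space \<Rightarrow> real"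
  assumes u: "loc_integrable u" and H: "smooth_on UNIV H"
    and K: "compact K" "\<And>x y. x \<in> cball x0 1 \<Longrightarrow> y \<notin> K \<Longrightarrow> H (x, y) = 0"
  shows "((\<lambda>x. \<integral>y. u y * H (x, y) \<partial>lborel) has_derivative
    (\<lambda>v. \<integral>y. u y * frechet_derivative H (at (x0, y)) (v, 0) \<partial>lborel)) (at x0)"
proof -
  define D where "D x y v = frechet_derivative H (at (x, y)) (v, 0)" for x y v
  have D: "((\<lambda>x. H (x, y)) has_derivative D x y) (at x)" for x y
    unfolding D_def
    by (rule has_derivative_compose[OF _ smooth_on_has_derivative[OF H]])
       (auto intro!: derivative_eq_intros)
  have lin: "linear (D x y)" for x y
    using D by (rule has_derivative_linear)
  have D0: "D x y v = 0" if "x \<in> ball x0 1" "y \<notin> K" for x y v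
  proof -
    have "((\<lambda>x. H (x, y)) has_derivative (\<lambda>v. 0)) (at x)"
      by (rule has_derivative_transform_within_open[OF has_derivative_const, where s="ball x0 1"])
         (use that K(2) in auto)
    then show ?thesis using has_derivative_unique[OF D] by metis
  qed
  have smD: "smooth_on UNIV (\<lambda>(x, y). D x y v)" for v
    using smooth_on_frechet_derivative[OF H, of "(v, 0)"] by (simp add: D_def case_prod_unfold)
  have contD: "continuous_on UNIV (\<lambda>y. D x y v)" for x v
    using continuous_on_compose2[OF smooth_on_continuous_on[OF smD[of v], of UNIV], of UNIV "\<lambda>y. (x, y)"]
    by (simp add: continuous_on_Pair)
  have contH: "continuous_on UNIV (\<lambda>y. H (x, y))" for x
    using continuous_on_compose2[OF smooth_on_continuous_on[OF H, of UNIV], of UNIV "\<lambda>y. (x, y)"]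
    by (simp add: continuous_on_Pair)
  have x0: "x0 \<in> ball x0 1" by simp
  have iD: "integrable lborel (\<lambda>y. u y * D x0 y v)" for v
    by (rule loc_integrable_mult_continuous[OF u contD K(1) D0[OF x0]])
  have iH: "integrable lborel (\<lambda>y. u y * H (x, y))" if "x \<in> cball x0 1" for x
    by (rule loc_integrable_mult_continuous[OF u contH K(1) K(2)[OF that]])
  define J where "J = (\<integral>y. indicator K y * \<bar>u y\<bar> \<partial>lborel)"
  have iJ: "integrable lborel (\<lambda>y. indicator K y * \<bar>u y\<bar>)"
  proof -
    have "set_integrable lborel K (\<lambda>y. \<bar>u y\<bar>)"
      using u K(1) by (intro set_integrable_abs) (auto simp: loc_integrable_def)
    then show ?thesis by (simp add: set_integrable_def)
  qed
  have J: "0 \<le> J" unfolding J_def by (intro Bochner_Integration.integral_nonneg) simp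
  let ?I = "\<lambda>x. \<integral>y. u y * H (x, y) \<partial>lborel" and ?I' = "\<lambda>v. \<integral>y. u y * D x0 y v \<partial>lborel"
  have "linear ?I'"
  proof
    show "?I' (v + w) = ?I' v + ?I' w" for v w
      using iD by (simp add: linear_add[OF lin] distrib_left)
    show "?I' (c *\<^sub>R v) = c *\<^sub>R ?I' v" for c v
      by (simp add: linear_cmul[OF lin] mult.left_commute)
  qed
  then have "bounded_linear ?I'"
    by (simp add: linear_conv_bounded_linear)
  moreover have "\<exists>d>0. \<forall>x. norm (x - x0) < d \<longrightarrow>
      norm (?I x - ?I x0 - ?I' (x - x0)) \<le> \<epsilon> * norm (x - x0)" if "\<epsilon> > 0" for \<epsilon>
  proof -
    \<comment> \<open>Chosen so that the final bound \<open>DIM('a) * \<epsilon>' * (J + 1)\<close>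
      is exactly \<open>\<epsilon>\<close>; \<open>J + 1\<close> replaces \<open>J\<close>, which
      may be zero.\<close>
    define \<epsilon>' where "\<epsilon>' = \<epsilon> / ((J + 1) * real DIM('a))"
    have \<epsilon>': "\<epsilon>' > 0" unfolding \<epsilon>'_def using that J by simp
    have "\<exists>d>0. \<forall>x\<in>ball x0 d. \<forall>y\<in>K. \<bar>D x y v - D x0 y v\<bar> \<le> \<epsilon>'" for v
    proof -
      have "uniformly_continuous_on (cball x0 1 \<times> K) (\<lambda>(x, y). D x y v)"
        by (intro compact_uniformly_continuous smooth_on_continuous_on smD compact_Times K compact_cball)
      then obtain d where d: "d > 0" "\<And>p q. p \<in> cball x0 1 \<times> K \<Longrightarrow> q \<in> cball x0 1 \<times> K \<Longrightarrow>
          dist q p < d \<Longrightarrow> dist ((\<lambda>(x, y). D x y v) q) ((\<lambda>(x, y). D x y v) p) < \<epsilon>'"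
        using \<epsilon>' unfolding uniformly_continuous_on_def by metis
      show ?thesis
      proof (intro exI[of _ "min d 1"] conjI ballI)
        fix x y assume "x \<in> ball x0 (min d 1)" "y \<in> K"
        then show "\<bar>D x y v - D x0 y v\<bar> \<le> \<epsilon>'"
          using d(2)[of "(x0, y)" "(x, y)"] by (auto simp: dist_Pair_Pair dist_commute dist_real_def)
      qed (use d in auto)
    qed
    then obtain d where d: "\<And>v. d v > 0" "\<And>v x y. x \<in> ball x0 (d v) \<Longrightarrow> y \<in> K \<Longrightarrow> \<bar>D x y v - D x0 y v\<bar> \<le> \<epsilon>'"
      by metis
    \<comment> \<open>A radius that serves all basis directions; the inserted 1 keeps
      \<open>x\<close> in the ball on which \<open>H\<close> vanishes for \<open>y\<close> outside
      \<open>K\<close>.\<close>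
    define \<delta> where "\<delta> = Min (insert 1 (d ` Basis))"
    have \<delta>: "0 < \<delta>" "\<delta> \<le> 1" "\<And>v. v \<in> Basis \<Longrightarrow> \<delta> \<le> d v"
      unfolding \<delta>_def using d(1) by (auto intro: min.coboundedI2)
    \<comment> \<open>Bounds in the basis directions give an operator norm bound, at the cost of the
      factor \<open>DIM('a)\<close>.\<close>
    have lip: "\<bar>D x y v - D x0 y v\<bar> \<le> (real DIM('a) * \<epsilon>') * norm v" if "x \<in> ball x0 \<delta>" "y \<in> K" for x y v
    proof -
      have rep: "D x y v = (\<Sum>b\<in>Basis. (v \<bullet> b) * D x y b)" for x y
      proof -
        have "D x y v = D x y (\<Sum>b\<in>Basis. (v \<bullet> b) *\<^sub>R b)"
          by (simp only: euclidean_representation)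
        then show ?thesis by (simp add: linear_sum[OF lin] linear_cmul[OF lin])
      qed
      have "\<bar>D x y v - D x0 y v\<bar> = \<bar>\<Sum>b\<in>Basis. (v \<bullet> b) * (D x y b - D x0 y b)\<bar>"
        unfolding rep[of x] rep[of x0] by (simp add: sum_subtractf right_diff_distrib)
      also have "\<dots> \<le> (\<Sum>b\<in>(Basis::'a set). norm v * \<epsilon>')"
      proof (rule order_trans[OF sum_abs], rule sum_mono)
        fix b :: 'a assume b: "b \<in> Basis"
        have "\<bar>D x y b - D x0 y b\<bar> \<le> \<epsilon>'"
          using that \<delta>(3)[OF b] by (intro d(2)[of x b y]) auto
        then show "\<bar>(v \<bullet> b) * (D x y b - D x0 y b)\<bar> \<le> norm v * \<epsilon>'"
          unfolding abs_mult by (intro mult_mono Basis_le_norm b) auto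
      qed
      finally show ?thesis by (simp add: mult_ac)
    qed
    have "norm (?I x - ?I x0 - ?I' (x - x0)) \<le> \<epsilon> * norm (x - x0)" if x: "norm (x - x0) < \<delta>" for x
    proof -
      have xb: "x \<in> ball x0 \<delta>" using x by (simp add: dist_norm norm_minus_commute)
      then have xb1: "x \<in> cball x0 1" using \<delta>(2) by auto
      define R where "R y = H (x, y) - H (x0, y) - D x0 y (x - x0)" for y
      define C where "C = norm (x - x0) * (real DIM('a) * \<epsilon>')"
      have R: "norm (u y * R y) \<le> C * (indicator K y * \<bar>u y\<bar>)" for y
      proof (cases "y \<in> K")
        case True
        have seg: "x0 + t *\<^sub>R (x - x0) \<in> ball x0 \<delta>" if "t \<in> {0..1}" for t
        proof -
          have "norm (t *\<^sub>R (x - x0)) \<le> 1 * norm (x - x0)"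
            unfolding norm_scaleR using that by (intro mult_right_mono) auto
          then show ?thesis using x by (simp add: dist_norm)
        qed
        have "norm (H (x, y) - H (x0, y) - D x0 y (x - x0)) \<le> C"
          unfolding C_def
        proof (rule differentiable_bound_linearization[where S="ball x0 \<delta>"])
          show "((\<lambda>x. H (x, y)) has_derivative D x' y) (at x' within ball x0 \<delta>)" for x'
            using D by (rule has_derivative_at_withinI)
          show "onorm (D x' y - D x0 y) \<le> real DIM('a) * \<epsilon>'" if "x' \<in> ball x0 \<delta>" for x'
            using lip[OF that True] \<epsilon>' by (intro onorm_bound) auto
        qed (use seg \<delta> in auto)
        then have "\<bar>u y\<bar> * \<bar>R y\<bar> \<le> \<bar>u y\<bar> * C"
          unfolding R_def by (intro mult_left_mono) auto
        then show ?thesis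
          using True by (simp add: abs_mult mult.commute)
      next
        case False
        then show ?thesis
          using K(2)[of x y] K(2)[of x0 y] D0[OF x0 False] xb1 by (simp add: R_def)
      qed
      have eq: "(\<lambda>y. u y * R y) = (\<lambda>y. u y * H (x, y) - u y * H (x0, y) - u y * D x0 y (x - x0))"
        by (simp add: R_def right_diff_distrib)
      have iR: "integrable lborel (\<lambda>y. u y * R y)"
        unfolding eq using iH[of x] iH[of x0] iD xb1 by (intro Bochner_Integration.integrable_diff) auto
      have "?I x - ?I x0 - ?I' (x - x0) = (\<integral>y. u y * R y \<partial>lborel)"
        unfolding eq using iH[of x] iH[of x0] iD xb1 by simp
      also have "norm \<dots> \<le> (\<integral>y. norm (u y * R y) \<partial>lborel)"
        by (rule integral_norm_bound)
      also have "\<dots> \<le> (\<integral>y. C * (indicator K y * \<bar>u y\<bar>) \<partial>lborel)"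
        using R iR iJ by (intro integral_mono integrable_norm integrable_mult_right) auto
      also have "\<dots> = C * J" by (simp add: J_def)
      also have "\<dots> \<le> C * (J + 1)"
        using \<epsilon>' by (intro mult_left_mono) (auto simp: C_def)
      also have "\<dots> = \<epsilon> * norm (x - x0)"
        using J by (simp add: C_def \<epsilon>'_def)
      finally show ?thesis .
    qed
    then show ?thesis using \<delta>(1) by blast
  qed
  ultimately show ?thesis
    unfolding has_derivative_at_alt D_def by blast
qed

text \<open>The derivative is again a parameter integral of the same kind, with a directional
  derivative of \<open>H\<close> as kernel. Hence the induction runs over all kernels, and the
  support condition is stated for every ball so that it survives differentiation.\<close>

lemma Ck_on_parameter_integral:
  fixes H :: "'a::euclidean_space \<times> 'b::euclidean_space \<Rightarrow> real"
  assumes u: "loc_integrable u"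
  shows "smooth_on UNIV H \<Longrightarrow>
    (\<And>r. \<exists>K. compact K \<and> (\<forall>x\<in>cball 0 r. \<forall>y. y \<notin> K \<longrightarrow> H (x, y) = 0)) \<Longrightarrow>
    Ck_on k UNIV (\<lambda>x. \<integral>y. u y * H (x, y) \<partial>lborel)"
proof (induction k arbitrary: H)
  have D: "((\<lambda>x. \<integral>y. u y * H (x, y) \<partial>lborel) has_derivative
    (\<lambda>v. \<integral>y. u y * frechet_derivative H (at (x, y)) (v, 0) \<partial>lborel)) (at x)"
    if H: "smooth_on UNIV H"
      "\<And>r. \<exists>K. compact K \<and> (\<forall>x\<in>cball 0 r. \<forall>y. y \<notin> K \<longrightarrow> H (x, y) = 0)" for H and x :: 'a
  proof -
    obtain K where K: "compact K" "\<And>x' y. x' \<in> cball 0 (norm x + 1) \<Longrightarrow> y \<notin> K \<Longrightarrow> H (x', y) = 0"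
      using H(2)[of "norm x + 1"] by blast
    have "x' \<in> cball 0 (norm x + 1)" if "x' \<in> cball x 1" for x'
      using that norm_triangle_ineq2[of x' x] by (simp add: dist_norm norm_minus_commute)
    then show ?thesis
      by (intro has_derivative_parameter_integral[OF u H(1) K(1)] K(2)) auto
  qed
  {
    case 0
    then show ?case
      by (auto intro!: continuous_at_imp_continuous_on has_derivative_continuous[OF D])
  next
    case (Suc k)
    show ?case
    proof (rule Ck_on_SucI[OF D[OF Suc.prems]])
      fix v
      show "Ck_on k UNIV (\<lambda>x. \<integral>y. u y * frechet_derivative H (at (x, y)) (v, 0) \<partial>lborel)"
      proof (rule Suc.IH[OF smooth_on_frechet_derivative[OF Suc.prems(1)]])
        fix r
        \<comment> \<open>The radius \<open>r + 1\<close> makes \<open>H\<close> vanish in a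
          neighbourhood of each point of \<open>cball 0 r\<close>, so that its derivative in
          \<open>x\<close> vanishes there too.\<close>
        obtain K where K: "compact K" "\<And>x y. x \<in> cball 0 (r + 1) \<Longrightarrow> y \<notin> K \<Longrightarrow> H (x, y) = 0"
          using Suc.prems(2)[of "r + 1"] by blast
        have "frechet_derivative H (at (x, y)) (v, 0) = 0" if "x \<in> cball 0 r" "y \<notin> K" for x y
        proof -
          have "((\<lambda>x. (x, y)) has_derivative (\<lambda>v. (v, 0))) (at x)"
            by (auto intro!: derivative_eq_intros)
          from has_derivative_compose[OF this smooth_on_has_derivative[OF Suc.prems(1)]]
          have "((\<lambda>x. H (x, y)) has_derivative (\<lambda>v. frechet_derivative H (at (x, y)) (v, 0))) (at x)" .
          moreover have "((\<lambda>x. H (x, y)) has_derivative (\<lambda>v. 0)) (at x)"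
            by (rule has_derivative_transform_within_open[OF has_derivative_const, where s="ball 0 (r + 1)"])
               (use that K(2) in auto)
          ultimately show ?thesis using has_derivative_unique by metis
        qed
        with K(1) show "\<exists>K. compact K \<and>
            (\<forall>x\<in>cball 0 r. \<forall>y. y \<notin> K \<longrightarrow> frechet_derivative H (at (x, y)) (v, 0) = 0)"
          by blast
      qed
    qed
  }
qed

lemma smooth_on_parameter_integral:
  fixes H :: "'a::euclidean_space \<times> 'b::euclidean_space \<Rightarrow> real"
  assumes "loc_integrable u" "smooth_on UNIV H"
    "\<And>r. \<exists>K. compact K \<and> (\<forall>x\<in>cball 0 r. \<forall>y. y \<notin> K \<longrightarrow> H (x, y) = 0)"
  shows "smooth_on UNIV (\<lambda>x. \<integral>y. u y * H (x, y) \<partial>lborel)"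
  unfolding smooth_on_def using Ck_on_parameter_integral[OF assms] by blast

section \<open>Groups with bi-invariant Lebesgue measure\<close>

locale unimodular_lie_group =
  fixes G :: "(real^'n::finite) monoid" (structure)
  assumes lie: "lie_group G"
    and left_inv: "left_invariant_lebesgue G"
    and right_inv: "right_invariant_lebesgue G"

sublocale unimodular_lie_group \<subseteq> group G
  using lie by (simp add: lie_group_def)

context unimodular_lie_group
begin

lemma in_carrier [simp]: "x \<in> carrier G"
  using lie by (simp add: lie_group_def)

lemma inv_mult_cancel [simp]: "inv x \<otimes> (x \<otimes> y) = y" "x \<otimes> (inv x \<otimes> y) = y"
    "(y \<otimes> x) \<otimes> inv x = y" "(y \<otimes> inv x) \<otimes> x = y"
  by (simp_all add: m_assoc[symmetric]) (simp_all add: m_assoc)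

lemma smooth_on_group_mult:
  fixes f g :: "'a::euclidean_space \<Rightarrow> real^'n"
  assumes "smooth_on UNIV f" "smooth_on UNIV g"
  shows "smooth_on UNIV (\<lambda>x. f x \<otimes> g x)"
  using smooth_on_compose[of "\<lambda>(x, y). x \<otimes> y", OF _ smooth_on_Pair[OF assms]] lie
  by (simp add: lie_group_def)

lemma smooth_on_inv: "smooth_on UNIV (\<lambda>x. inv x)"
  using lie by (simp add: lie_group_def)

lemma smooth_on_translate: "smooth_on UNIV (\<lambda>x. \<alpha> \<otimes> x)" "smooth_on UNIV (\<lambda>x. x \<otimes> \<alpha>)"
  using smooth_on_bounded_linear[OF bounded_linear_ident]
  by (auto intro: smooth_on_group_mult)

lemma continuous_on_group_mult:
  fixes f g :: "'a::topological_space \<Rightarrow> real^'n"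
  assumes "continuous_on S f" "continuous_on S g"
  shows "continuous_on S (\<lambda>x. f x \<otimes> g x)"
proof -
  have "continuous_on UNIV (\<lambda>(x, y). x \<otimes> y)"
    using lie by (intro smooth_on_continuous_on) (simp add: lie_group_def)
  from continuous_on_compose2[OF this continuous_on_Pair[OF assms]] show ?thesis by simp
qed

lemma borel_measurable_group_mult [measurable (raw)]:
  fixes f g :: "'a \<Rightarrow> real^'n"
  assumes "f \<in> borel_measurable M" "g \<in> borel_measurable M"
  shows "(\<lambda>x. f x \<otimes> g x) \<in> borel_measurable M"
  by (rule borel_measurable_continuous_Pair[OF assms])
     (intro continuous_on_group_mult continuous_intros)

lemma compact_group_mult:
  assumes "compact K" "compact K'"
  shows "compact ((\<lambda>(x, y). x \<otimes> y) ` (K \<times> K'))"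
  unfolding case_prod_unfold
  by (intro compact_continuous_image compact_Times assms continuous_on_group_mult continuous_intros)

text \<open>Invariance is assumed for images, whereas \<open>distr\<close> takes preimages; a
  preimage under translation by \<open>\<alpha>\<close> is an image under translation by its
  inverse.\<close>

lemma distr_left: "distr lborel borel (\<lambda>x. \<alpha> \<otimes> x) = lborel"
proof (rule measure_eqI)
  fix E assume "E \<in> sets (distr lborel borel (\<lambda>x. \<alpha> \<otimes> x))"
  then have E [measurable]: "E \<in> sets borel" by simp
  have im: "(\<lambda>x. \<alpha> \<otimes> x) -` E = (\<lambda>x. inv \<alpha> \<otimes> x) ` E"
    by (auto simp: image_iff) (metis inv_mult_cancel(1))
  have pre: "(\<lambda>x. \<alpha> \<otimes> x) -` E \<in> sets borel"
    using measurable_sets[of "\<lambda>x. \<alpha> \<otimes> x" borel borel E] by simp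
  have "emeasure (distr lborel borel (\<lambda>x. \<alpha> \<otimes> x)) E = emeasure lborel ((\<lambda>x. \<alpha> \<otimes> x) -` E)"
    by (subst emeasure_distr) auto
  also have "\<dots> = emeasure lebesgue ((\<lambda>x. inv \<alpha> \<otimes> x) ` E)"
    using pre by (simp add: im)
  also have "\<dots> = emeasure lebesgue E"
    using left_inv E unfolding left_invariant_lebesgue_def by (metis sets_completionI_sets sets_lborel)
  finally show "emeasure (distr lborel borel (\<lambda>x. \<alpha> \<otimes> x)) E = emeasure lborel E"
    by simp
qed simp

lemma distr_right: "distr lborel borel (\<lambda>x. x \<otimes> \<alpha>) = lborel"
proof (rule measure_eqI)
  fix E assume "E \<in> sets (distr lborel borel (\<lambda>x. x \<otimes> \<alpha>))"
  then have E [measurable]: "E \<in> sets borel" by simp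
  have im: "(\<lambda>x. x \<otimes> \<alpha>) -` E = (\<lambda>x. x \<otimes> inv \<alpha>) ` E"
    by (auto simp: image_iff) (metis inv_mult_cancel(3))
  have pre: "(\<lambda>x. x \<otimes> \<alpha>) -` E \<in> sets borel"
    using measurable_sets[of "\<lambda>x. x \<otimes> \<alpha>" borel borel E] by simp
  have "emeasure (distr lborel borel (\<lambda>x. x \<otimes> \<alpha>)) E = emeasure lborel ((\<lambda>x. x \<otimes> \<alpha>) -` E)"
    by (subst emeasure_distr) auto
  also have "\<dots> = emeasure lebesgue ((\<lambda>x. x \<otimes> inv \<alpha>) ` E)"
    using pre by (simp add: im)
  also have "\<dots> = emeasure lebesgue E"
    using right_inv E unfolding right_invariant_lebesgue_def by (metis sets_completionI_sets sets_lborel)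
  finally show "emeasure (distr lborel borel (\<lambda>x. x \<otimes> \<alpha>)) E = emeasure lborel E"
    by simp
qed simp

lemma
  fixes f :: "real^'n \<Rightarrow> real"
  assumes [measurable]: "f \<in> borel_measurable borel"
  shows integral_left_translate: "(\<integral>x. f (\<alpha> \<otimes> x) \<partial>lborel) = integral\<^sup>L lborel f"
    and integrable_left_translate: "integrable lborel (\<lambda>x. f (\<alpha> \<otimes> x)) \<longleftrightarrow> integrable lborel f"
    and integral_right_translate: "(\<integral>x. f (x \<otimes> \<alpha>) \<partial>lborel) = integral\<^sup>L lborel f"
    and integrable_right_translate: "integrable lborel (\<lambda>x. f (x \<otimes> \<alpha>)) \<longleftrightarrow> integrable lborel f"
  using integral_distr[of "\<lambda>x. \<alpha> \<otimes> x" lborel borel f] integral_distr[of "\<lambda>x. x \<otimes> \<alpha>" lborel borel f]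
    integrable_distr_eq[of "\<lambda>x. \<alpha> \<otimes> x" lborel borel f] integrable_distr_eq[of "\<lambda>x. x \<otimes> \<alpha>" lborel borel f]
  by (simp_all add: distr_left distr_right)

lemma test_functions_left_translate:
  assumes "\<psi> \<in> test_functions UNIV"
  shows "(\<lambda>x. \<psi> (\<alpha> \<otimes> x)) \<in> test_functions UNIV"
proof (rule test_functionsI)
  show "smooth_on UNIV (\<lambda>x. \<psi> (\<alpha> \<otimes> x))"
    by (rule smooth_on_compose[OF test_functions_smooth[OF assms] smooth_on_translate(1)])
  show "compact ((\<lambda>x. inv \<alpha> \<otimes> x) ` supp \<psi>)"
    by (intro compact_continuous_image smooth_on_continuous_on smooth_on_translate
        test_functions_compact assms)
  show "\<psi> (\<alpha> \<otimes> x) = 0" if "x \<notin> (\<lambda>x. inv \<alpha> \<otimes> x) ` supp \<psi>" for x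
  proof (rule ccontr)
    assume "\<psi> (\<alpha> \<otimes> x) \<noteq> 0"
    then have "inv \<alpha> \<otimes> (\<alpha> \<otimes> x) \<in> (\<lambda>x. inv \<alpha> \<otimes> x) ` supp \<psi>"
      by (intro imageI in_supp)
    then show False using that by simp
  qed
qed

end

section \<open>A convex function of power growth\<close>

text \<open>The function \<open>F\<close> of the overview, t exp(-1/t) for positive t: a smooth
  convex substitute for the positive part. It is flatter than every power at 0 and grows linearly at
  infinity, so one function serves every exponent \<open>p \<ge> 1\<close>.\<close>

definition soft_pos :: "real \<Rightarrow> real" where
  "soft_pos t = t * flat 0 t"

lemma soft_pos_derivs:
  "(soft_pos has_real_derivative (flat 0 t + flat 1 t)) (at t)"
  "((\<lambda>t. flat 0 t + flat 1 t) has_real_derivative flat 3 t) (at t)"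
proof -
  have "flat 2 t * t = flat 1 t"
    by (simp add: flat_def power2_eq_square)
  then have "((\<lambda>t. t * flat 0 t) has_real_derivative (flat 0 t + flat 1 t)) (at t)"
    using DERIV_mult[OF DERIV_ident flat_has_derivative[of 0 t]] by (simp add: add.commute numeral_2_eq_2)
  then show "(soft_pos has_real_derivative (flat 0 t + flat 1 t)) (at t)"
    by (simp add: soft_pos_def[abs_def])
  show "((\<lambda>t. flat 0 t + flat 1 t) has_real_derivative flat 3 t) (at t)"
    by (auto intro!: derivative_eq_intros flat_has_derivative simp: numeral_eq_Suc)
qed

lemma smooth_on_soft_pos: "smooth_on UNIV soft_pos"
  unfolding soft_pos_def[abs_def]
  by (intro smooth_on_mult smooth_on_flat smooth_on_bounded_linear bounded_linear_ident)

lemma smooth_on_soft_pos_deriv: "smooth_on UNIV (\<lambda>t. flat 0 t + flat 1 t)"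
  by (intro smooth_on_add smooth_on_flat)

lemma soft_pos_nonneg: "0 \<le> soft_pos t"
  by (auto simp: soft_pos_def flat_def)

lemma soft_pos_pos: "0 < t \<Longrightarrow> 0 < soft_pos t"
  by (simp add: soft_pos_def flat_def)

text \<open>Convexity as a supporting line at \<open>a\<close>, the form in which Jensen's
  inequality is derived below.\<close>

lemma soft_pos_tangent: "soft_pos a + (flat 0 a + flat 1 a) * (t - a) \<le> soft_pos t"
  using f''_imp_f'[OF convex_UNIV soft_pos_derivs(1) soft_pos_derivs(2) flat_nonneg, of a t] by simp

lemma soft_pos_mono:
  assumes "s \<le> t"
  shows "soft_pos s \<le> soft_pos t"
proof -
  have "0 \<le> (flat 0 s + flat 1 s) * (t - s)"
    using assms by (intro mult_nonneg_nonneg add_nonneg_nonneg flat_nonneg) simp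
  then show ?thesis using soft_pos_tangent[of s t] by linarith
qed

lemma soft_pos_le_powr:
  assumes "p \<ge> 1"
  shows "soft_pos t \<le> (1 + p powr p) * \<bar>t\<bar> powr p"
proof -
  consider "t \<le> 0" | "t \<ge> 1" | "0 < t" "t < 1" by linarith
  then show ?thesis
  proof cases
    case 1
    then show ?thesis by (simp add: soft_pos_def flat_def)
  next
    case 2
    have "soft_pos t \<le> t * 1"
      unfolding soft_pos_def using 2 by (intro mult_left_mono) (auto simp: flat_def)
    also have "t * 1 \<le> t powr p"
      using 2 assms powr_mono[of 1 p t] by simp
    also have "\<dots> \<le> (1 + p powr p) * t powr p"
      by (simp add: distrib_right)
    finally show ?thesis using 2 by simp
  next
    case 3
    \<comment> \<open>The argument 1/(pt) is chosen so that the \<open>p\<close>-th power of the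
      right-hand side is exp(1/t); this is the source of the constant \<open>p powr p\<close>. The
      summand 1 of the constant serves the case \<open>t \<ge> 1\<close>.\<close>
    have "1 / (p * t) \<le> exp (1 / (p * t))"
      using exp_ge_add_one_self[of "1 / (p * t)"] by linarith
    then have "(1 / (p * t)) powr p \<le> exp (1 / (p * t)) powr p"
      using assms 3 by (intro powr_mono2) auto
    also have "\<dots> = exp (1 / t)"
      using assms 3 by (simp add: powr_def)
    finally have "exp (- (1 / t)) \<le> inverse ((1 / (p * t)) powr p)"
      unfolding exp_minus using assms 3 by (intro le_imp_inverse_le) auto
    also have "\<dots> = p powr p * t powr p"
      using assms 3 by (simp add: powr_divide powr_mult)
    finally have e: "exp (- (1 / t)) \<le> p powr p * t powr p" .
    have "soft_pos t \<le> 1 * exp (- (1 / t))"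
      unfolding soft_pos_def using 3 by (intro mult_mono) (auto simp: flat_def)
    also have "\<dots> \<le> (1 + p powr p) * t powr p"
      using add_mono[OF powr_ge_zero[of t p] e] by (simp add: distrib_right)
    finally show ?thesis using 3 by simp
  qed
qed

section \<open>Mollification by left translations\<close>

context unimodular_lie_group
begin

text \<open>An average over left translates, with which the operator commutes. The weight
  \<open>\<phi>\<close> is not concentrated near a point: at the neutral element the average is
  already the integral of \<open>u\<close> against \<open>\<phi>\<close>.\<close>

definition mollify :: "(real^'n \<Rightarrow> real) \<Rightarrow> (real^'n \<Rightarrow> real) \<Rightarrow> real^'n \<Rightarrow> real" where
  "mollify \<phi> u x = (\<integral>\<alpha>. u (\<alpha> \<otimes> x) * \<phi> \<alpha> \<partial>lborel)"

text \<open>Right invariance allows the substitution \<open>y = \<alpha> \<otimes> x\<close>, which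
  moves \<open>x\<close> from the rough factor \<open>u\<close> to the smooth factor
  \<open>\<phi>\<close>. Differentiation under the integral then becomes possible.\<close>

lemma
  assumes u: "loc_integrable u" and \<phi>: "\<phi> \<in> test_functions UNIV"
  shows mollify_eq: "mollify \<phi> u x = (\<integral>y. u y * \<phi> (y \<otimes> inv x) \<partial>lborel)"
    and integrable_mollify: "integrable lborel (\<lambda>\<alpha>. u (\<alpha> \<otimes> x) * \<phi> \<alpha>)"
proof -
  note s\<phi> = test_functions_smooth[OF \<phi>]
  have [measurable]: "u \<in> borel_measurable borel" "\<phi> \<in> borel_measurable borel"
    using loc_integrable_measurable[OF u] smooth_on_borel_measurable[OF s\<phi>] by auto
  let ?f = "\<lambda>y. u y * \<phi> (y \<otimes> inv x)"
  have m: "?f \<in> borel_measurable borel" by measurable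
  have f: "?f (\<alpha> \<otimes> x) = u (\<alpha> \<otimes> x) * \<phi> \<alpha>" for \<alpha> by simp
  show "mollify \<phi> u x = (\<integral>y. ?f y \<partial>lborel)"
    using integral_right_translate[OF m, of x] unfolding f mollify_def .
  have "integrable lborel ?f"
  proof (rule loc_integrable_mult_continuous[OF u])
    show "continuous_on UNIV (\<lambda>y. \<phi> (y \<otimes> inv x))"
      by (intro smooth_on_continuous_on smooth_on_compose[OF s\<phi> smooth_on_translate(2)])
    show "compact ((\<lambda>y. y \<otimes> x) ` supp \<phi>)"
      by (intro compact_continuous_image smooth_on_continuous_on smooth_on_translate
          test_functions_compact \<phi>)
    show "\<phi> (y \<otimes> inv x) = 0" if "y \<notin> (\<lambda>y. y \<otimes> x) ` supp \<phi>" for y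
      using that in_supp[of \<phi> "y \<otimes> inv x"] by (metis image_eqI inv_mult_cancel(4))
  qed
  then show "integrable lborel (\<lambda>\<alpha>. u (\<alpha> \<otimes> x) * \<phi> \<alpha>)"
    using integrable_right_translate[OF m, of x] unfolding f by simp
qed

lemma smooth_on_mollify:
  assumes u: "loc_integrable u" and \<phi>: "\<phi> \<in> test_functions UNIV"
  shows "smooth_on UNIV (mollify \<phi> u)"
proof -
  let ?H = "\<lambda>q. \<phi> (snd q \<otimes> inv (fst q))"
  have "smooth_on UNIV (\<lambda>x. \<integral>y. u y * ?H (x, y) \<partial>lborel)"
  proof (rule smooth_on_parameter_integral[OF u])
    have "smooth_on UNIV (\<lambda>q :: (real^'n) \<times> (real^'n). snd q \<otimes> inv (fst q))"
      by (intro smooth_on_group_mult smooth_on_compose[OF smooth_on_inv] smooth_on_bounded_linear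
          bounded_linear_fst bounded_linear_snd)
    then show "smooth_on UNIV ?H"
      by (rule smooth_on_compose[OF test_functions_smooth[OF \<phi>]])
    fix r
    \<comment> \<open>If the kernel is nonzero at \<open>(x, y)\<close>, then \<open>y\<close> is
      the product of \<open>y \<otimes> inv x\<close> in \<open>supp \<phi>\<close> and
      \<open>x\<close> in the ball.\<close>
    let ?K = "(\<lambda>(x, y). x \<otimes> y) ` (supp \<phi> \<times> cball 0 r)"
    have "compact ?K"
      by (intro compact_group_mult test_functions_compact \<phi> compact_cball)
    moreover have "?H (x, y) = 0" if "x \<in> cball 0 r" "y \<notin> ?K" for x y
    proof (rule ccontr)
      assume "?H (x, y) \<noteq> 0"
      then have "(y \<otimes> inv x, x) \<in> supp \<phi> \<times> cball 0 r"
        using that(1) in_supp[of \<phi>] by simp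
      then have "(\<lambda>(x, y). x \<otimes> y) (y \<otimes> inv x, x) \<in> ?K" by (rule imageI)
      then show False using that(2) by simp
    qed
    ultimately show "\<exists>K. compact K \<and> (\<forall>x\<in>cball 0 r. \<forall>y. y \<notin> K \<longrightarrow> ?H (x, y) = 0)"
      by blast
  qed
  then show ?thesis
    by (simp add: mollify_eq[OF u \<phi>, abs_def])
qed

lemma integral_mollify_mult:
  assumes u: "loc_integrable u" and \<phi>: "\<phi> \<in> test_functions UNIV" and h: "h \<in> test_functions UNIV"
  shows "(\<integral>x. mollify \<phi> u x * h x \<partial>lborel) = (\<integral>\<alpha>. (\<integral>x. u (\<alpha> \<otimes> x) * h x \<partial>lborel) * \<phi> \<alpha> \<partial>lborel)"
proof -
  note s\<phi> = test_functions_smooth[OF \<phi>] and sh = test_functions_smooth[OF h]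
  have [measurable]: "u \<in> borel_measurable borel" "\<phi> \<in> borel_measurable borel" "h \<in> borel_measurable borel"
    using loc_integrable_measurable[OF u] smooth_on_borel_measurable[OF s\<phi>] smooth_on_borel_measurable[OF sh]
    by auto
  define K where "K = (\<lambda>(x, y). x \<otimes> y) ` (supp \<phi> \<times> supp h)"
  have K: "compact K"
    unfolding K_def by (intro compact_group_mult test_functions_compact \<phi> h)
  then have [measurable]: "K \<in> sets borel" by (rule borel_compact)
  \<comment> \<open>All products of points of \<open>supp \<phi>\<close> and \<open>supp h\<close>
    lie in \<open>K\<close>, so cutting \<open>\<bar>u\<bar>\<close> off outside \<open>K\<close>
    gives an integrable majorant. By left invariance the integral of its left translates does not
    depend on \<open>\<alpha>\<close>, as Fubini's theorem requires here.\<close>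
  define U where "U y = indicator K y * \<bar>u y\<bar>" for y
  have Um [measurable]: "U \<in> borel_measurable borel" unfolding U_def by measurable
  have iU: "integrable lborel U"
  proof -
    have "set_integrable lborel K (\<lambda>y. \<bar>u y\<bar>)"
      using u K by (intro set_integrable_abs) (auto simp: loc_integrable_def)
    then show ?thesis by (simp add: set_integrable_def U_def[abs_def])
  qed
  have U0: "0 \<le> U y" for y by (simp add: U_def)
  obtain C where C: "0 \<le> C" "\<And>x. \<bar>h x\<bar> \<le> C"
    using continuous_compact_bounded[OF smooth_on_continuous_on[OF sh] test_functions_compact[OF h]]
      in_supp[of h] by metis
  have bd: "norm (u (\<alpha> \<otimes> x) * \<phi> \<alpha> * h x) \<le> (C * \<bar>\<phi> \<alpha>\<bar>) * U (\<alpha> \<otimes> x)" for \<alpha> x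
  proof (cases "\<phi> \<alpha> = 0 \<or> h x = 0")
    case True
    then show ?thesis using C(1) U0[of "\<alpha> \<otimes> x"] by auto
  next
    case False
    then have "(\<alpha>, x) \<in> supp \<phi> \<times> supp h" by (simp add: in_supp)
    then have "(\<lambda>(x, y). x \<otimes> y) (\<alpha>, x) \<in> K" unfolding K_def by (rule imageI)
    then have "U (\<alpha> \<otimes> x) = \<bar>u (\<alpha> \<otimes> x)\<bar>" by (simp add: U_def)
    moreover have "\<bar>u (\<alpha> \<otimes> x)\<bar> * \<bar>\<phi> \<alpha>\<bar> * \<bar>h x\<bar> \<le> \<bar>u (\<alpha> \<otimes> x)\<bar> * \<bar>\<phi> \<alpha>\<bar> * C"
      by (intro mult_left_mono C) simp
    ultimately show ?thesis by (simp add: abs_mult mult_ac)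
  qed
  have i\<phi>: "integrable lborel (\<lambda>\<alpha>. \<bar>\<phi> \<alpha>\<bar>)"
    using loc_integrable_mult_test[OF loc_integrable_continuous[of "\<lambda>x. 1"] \<phi>]
    by (intro integrable_abs) simp
  have dom: "integrable (lborel \<Otimes>\<^sub>M lborel) (\<lambda>(\<alpha>, x). (C * \<bar>\<phi> \<alpha>\<bar>) * U (\<alpha> \<otimes> x))"
  proof (rule lborel_pair.Fubini_integrable)
    have "(\<integral>x. norm (case (\<alpha>, x) of (\<alpha>, x) \<Rightarrow> (C * \<bar>\<phi> \<alpha>\<bar>) * U (\<alpha> \<otimes> x)) \<partial>lborel)
        = (C * \<bar>\<phi> \<alpha>\<bar>) * integral\<^sup>L lborel U" for \<alpha>
      using C(1) U0 by (simp add: abs_mult integral_left_translate[OF Um])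
    then show "integrable lborel (\<lambda>\<alpha>. \<integral>x. norm (case (\<alpha>, x) of (\<alpha>, x) \<Rightarrow> (C * \<bar>\<phi> \<alpha>\<bar>) * U (\<alpha> \<otimes> x)) \<partial>lborel)"
      using i\<phi> by simp
    show "AE \<alpha> in lborel. integrable lborel (\<lambda>x. case (\<alpha>, x) of (\<alpha>, x) \<Rightarrow> (C * \<bar>\<phi> \<alpha>\<bar>) * U (\<alpha> \<otimes> x))"
      using iU integrable_left_translate[OF Um] by simp
  qed measurable
  have int: "integrable (lborel \<Otimes>\<^sub>M lborel) (\<lambda>(\<alpha>, x). u (\<alpha> \<otimes> x) * \<phi> \<alpha> * h x)"
  proof (rule Bochner_Integration.integrable_bound[OF dom])
    show "AE q in lborel \<Otimes>\<^sub>M lborel. norm (case q of (\<alpha>, x) \<Rightarrow> u (\<alpha> \<otimes> x) * \<phi> \<alpha> * h x)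
        \<le> norm (case q of (\<alpha>, x) \<Rightarrow> (C * \<bar>\<phi> \<alpha>\<bar>) * U (\<alpha> \<otimes> x))"
      using bd by (auto intro!: AE_I2 order_trans[OF _ abs_ge_self])
  qed measurable
  have "(\<integral>x. mollify \<phi> u x * h x \<partial>lborel) = (\<integral>x. (\<integral>\<alpha>. u (\<alpha> \<otimes> x) * \<phi> \<alpha> * h x \<partial>lborel) \<partial>lborel)"
    by (simp add: mollify_def)
  also have "\<dots> = (\<integral>\<alpha>. (\<integral>x. u (\<alpha> \<otimes> x) * \<phi> \<alpha> * h x \<partial>lborel) \<partial>lborel)"
    by (rule lborel_pair.Fubini_integral[OF int])
  also have "(\<lambda>\<alpha>. \<integral>x. u (\<alpha> \<otimes> x) * \<phi> \<alpha> * h x \<partial>lborel)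
      = (\<lambda>\<alpha>. (\<integral>x. u (\<alpha> \<otimes> x) * h x \<partial>lborel) * \<phi> \<alpha>)"
    by (simp add: mult.assoc mult.commute[of "\<phi> _"] flip: integral_mult_left_zero)
  finally show ?thesis .
qed

text \<open>Jensen's inequality for the probability density \<open>\<phi>\<close> bounds the
  function by the mollification of \<open>soft_pos (u x)\<close>, which is integrable by Fubini's
  theorem and left invariance.\<close>

lemma integrable_soft_pos_mollify:
  assumes u: "loc_integrable u" and iu: "integrable lborel (\<lambda>x. soft_pos (u x))"
    and \<phi>: "\<phi> \<in> test_functions UNIV" "\<And>x. 0 \<le> \<phi> x" "(\<integral>x. \<phi> x \<partial>lborel) = 1"
  shows "integrable lborel (\<lambda>x. soft_pos (mollify \<phi> u x))"
proof -
  note s\<phi> = test_functions_smooth[OF \<phi>(1)]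
  have [measurable]: "u \<in> borel_measurable borel" "\<phi> \<in> borel_measurable borel" "soft_pos \<in> borel_measurable borel"
    using loc_integrable_measurable[OF u] smooth_on_borel_measurable[OF s\<phi>]
      smooth_on_borel_measurable[OF smooth_on_soft_pos] by auto
  have m [measurable]: "mollify \<phi> u \<in> borel_measurable borel"
    by (rule smooth_on_borel_measurable[OF smooth_on_mollify[OF u \<phi>(1)]])
  let ?U = "\<lambda>x. soft_pos (u x)"
  have Um: "?U \<in> borel_measurable borel" by measurable
  have lU: "loc_integrable ?U"
    unfolding loc_integrable_def set_integrable_def
    by (intro conjI allI impI Um integrable_mult_indicator iu) (simp add: borel_compact)
  have i\<phi>: "integrable lborel \<phi>"
    using loc_integrable_mult_test[OF loc_integrable_continuous[of "\<lambda>x. 1"] \<phi>(1)] by simp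
  have int: "integrable (lborel \<Otimes>\<^sub>M lborel) (\<lambda>(\<alpha>, x). ?U (\<alpha> \<otimes> x) * \<phi> \<alpha>)"
  proof (rule lborel_pair.Fubini_integrable)
    have "(\<integral>x. norm (case (\<alpha>, x) of (\<alpha>, x) \<Rightarrow> ?U (\<alpha> \<otimes> x) * \<phi> \<alpha>) \<partial>lborel) = integral\<^sup>L lborel ?U * \<phi> \<alpha>" for \<alpha>
      using \<phi>(2) soft_pos_nonneg by (simp add: abs_mult integral_left_translate[OF Um])
    then show "integrable lborel (\<lambda>\<alpha>. \<integral>x. norm (case (\<alpha>, x) of (\<alpha>, x) \<Rightarrow> ?U (\<alpha> \<otimes> x) * \<phi> \<alpha>) \<partial>lborel)"
      using i\<phi> by simp
    show "AE \<alpha> in lborel. integrable lborel (\<lambda>x. case (\<alpha>, x) of (\<alpha>, x) \<Rightarrow> ?U (\<alpha> \<otimes> x) * \<phi> \<alpha>)"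
      using iu integrable_left_translate[OF Um] by simp
  qed measurable
  show ?thesis
  proof (rule Bochner_Integration.integrable_bound)
    show "integrable lborel (mollify \<phi> ?U)"
      using lborel_pair.integrable_snd[OF int] by (simp add: mollify_def[abs_def])
    show "AE x in lborel. norm (soft_pos (mollify \<phi> u x)) \<le> norm (mollify \<phi> ?U x)"
    proof (rule AE_I2)
      fix x
      let ?a = "mollify \<phi> u x" and ?d = "\<lambda>a. flat 0 a + flat 1 a"
      note i1 = integrable_mollify[OF u \<phi>(1), of x] and i2 = integrable_mollify[OF lU \<phi>(1), of x]
      \<comment> \<open>The supporting line at the mean \<open>?a\<close> is integrated against
        \<open>\<phi>\<close>. Since \<open>\<phi>\<close> has mass 1 and \<open>?a\<close> is the
        mean of \<open>u\<close>, the linear part cancels and \<open>soft_pos ?a\<close>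
        remains.\<close>
      have "(\<integral>\<alpha>. (soft_pos ?a - ?d ?a * ?a) * \<phi> \<alpha> + ?d ?a * (u (\<alpha> \<otimes> x) * \<phi> \<alpha>) \<partial>lborel) \<le> mollify \<phi> ?U x"
        unfolding mollify_def[of \<phi> ?U]
      proof (intro integral_mono i2 Bochner_Integration.integrable_add integrable_mult_right i1 i\<phi>)
        fix \<alpha>
        have "(soft_pos ?a + ?d ?a * (u (\<alpha> \<otimes> x) - ?a)) * \<phi> \<alpha> \<le> ?U (\<alpha> \<otimes> x) * \<phi> \<alpha>"
          by (intro mult_right_mono soft_pos_tangent \<phi>(2))
        then show "(soft_pos ?a - ?d ?a * ?a) * \<phi> \<alpha> + ?d ?a * (u (\<alpha> \<otimes> x) * \<phi> \<alpha>) \<le> ?U (\<alpha> \<otimes> x) * \<phi> \<alpha>"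
          by (simp add: algebra_simps)
      qed
      also have "(\<integral>\<alpha>. (soft_pos ?a - ?d ?a * ?a) * \<phi> \<alpha> + ?d ?a * (u (\<alpha> \<otimes> x) * \<phi> \<alpha>) \<partial>lborel)
          = (soft_pos ?a - ?d ?a * ?a) * 1 + ?d ?a * ?a"
        using i1 i\<phi> \<phi>(3) by (simp add: mollify_def)
      finally show "norm (soft_pos ?a) \<le> norm (mollify \<phi> ?U x)"
        using soft_pos_nonneg[of ?a] by simp
    qed
  qed measurable
qed

end

section \<open>Invariant operators\<close>

locale invariant_operator = smooth_operator A b + unimodular_lie_group G
  for A :: "real^'n \<Rightarrow> real^'n^'n::finite" and b :: "real^'n \<Rightarrow> real^'n"
    and G :: "(real^'n) monoid" (structure) +
  assumes A_nonneg: "\<And>x \<xi>. 0 \<le> (A x *v \<xi>) \<bullet> \<xi>"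
    and L_invariant: "left_translation_invariant_op G (diff_op A b)"
begin

section \<open>Invariance of the adjoint and preservation of subsolutions\<close>

lemma diff_op_left_translate:
  "smooth_on UNIV w \<Longrightarrow> diff_op A b (\<lambda>y. w (\<alpha> \<otimes> y)) x = diff_op A b w (\<alpha> \<otimes> x)"
  using L_invariant by (simp add: left_translation_invariant_op_def)

text \<open>Duality: paired with a test function, the translation is moved across by left invariance
  of the measure and of the operator. The identity is used only under an integral, where almost
  everywhere suffices.\<close>

lemma adjoint_op_left_translate_AE:
  assumes \<psi>: "\<psi> \<in> test_functions UNIV"
  shows "AE x in lborel. adjoint_op A b (\<lambda>y. \<psi> (\<alpha> \<otimes> y)) x = adjoint_op A b \<psi> (\<alpha> \<otimes> x)"
proof -
  let ?\<psi>\<alpha> = "\<lambda>y. \<psi> (\<alpha> \<otimes> y)"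
  have \<psi>\<alpha>: "?\<psi>\<alpha> \<in> test_functions UNIV"
    by (rule test_functions_left_translate[OF \<psi>])
  have t1: "adjoint_op A b ?\<psi>\<alpha> \<in> test_functions UNIV"
    by (rule adjoint_op_test[OF \<psi>\<alpha>])
  have t2: "(\<lambda>x. adjoint_op A b \<psi> (\<alpha> \<otimes> x)) \<in> test_functions UNIV"
    by (rule test_functions_left_translate[OF adjoint_op_test[OF \<psi>]])
  have "AE x in lborel. adjoint_op A b ?\<psi>\<alpha> x - adjoint_op A b \<psi> (\<alpha> \<otimes> x) = 0"
  proof (rule AE_eq_0_of_test_functions)
    show "loc_integrable (\<lambda>x. adjoint_op A b ?\<psi>\<alpha> x - adjoint_op A b \<psi> (\<alpha> \<otimes> x))"
      by (intro loc_integrable_continuous continuous_on_diff smooth_on_continuous_on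
          test_functions_smooth t1 t2)
    fix \<phi> :: "real^'n \<Rightarrow> real" assume \<phi>: "\<phi> \<in> test_functions UNIV"
    note s\<phi> = test_functions_smooth[OF \<phi>]
    have s\<phi>': "smooth_on UNIV (\<lambda>x. \<phi> (inv \<alpha> \<otimes> x))"
      by (rule smooth_on_compose[OF s\<phi> smooth_on_translate(1)])
    have l\<phi>: "loc_integrable \<phi>"
      by (intro loc_integrable_continuous smooth_on_continuous_on s\<phi>)
    have [measurable]: "\<phi> \<in> borel_measurable borel" "diff_op A b \<phi> \<in> borel_measurable borel"
        "\<psi> \<in> borel_measurable borel" "adjoint_op A b \<psi> \<in> borel_measurable borel"
      by (intro smooth_on_borel_measurable smooth_on_diff_op smooth_on_adjoint_op s\<phi>
          test_functions_smooth[OF \<psi>])+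
    have "(\<integral>x. \<phi> x * adjoint_op A b ?\<psi>\<alpha> x \<partial>lborel) = (\<integral>x. diff_op A b \<phi> x * \<psi> (\<alpha> \<otimes> x) \<partial>lborel)"
      by (rule integral_diff_op_adjoint_op[OF s\<phi> \<psi>\<alpha>])
    also have "\<dots> = (\<integral>x. diff_op A b \<phi> (inv \<alpha> \<otimes> x) * \<psi> x \<partial>lborel)"
      using integral_left_translate[of "\<lambda>x. diff_op A b \<phi> (inv \<alpha> \<otimes> x) * \<psi> x" \<alpha>] by simp
    also have "\<dots> = (\<integral>x. \<phi> (inv \<alpha> \<otimes> x) * adjoint_op A b \<psi> x \<partial>lborel)"
      using integral_diff_op_adjoint_op[OF s\<phi>' \<psi>] by (simp add: diff_op_left_translate[OF s\<phi>])
    also have "\<dots> = (\<integral>x. \<phi> x * adjoint_op A b \<psi> (\<alpha> \<otimes> x) \<partial>lborel)"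
      using integral_left_translate[of "\<lambda>x. \<phi> (inv \<alpha> \<otimes> x) * adjoint_op A b \<psi> x" \<alpha>] by simp
    finally have "(\<integral>x. \<phi> x * adjoint_op A b ?\<psi>\<alpha> x - \<phi> x * adjoint_op A b \<psi> (\<alpha> \<otimes> x) \<partial>lborel) = 0"
      using loc_integrable_mult_test[OF l\<phi> t1] loc_integrable_mult_test[OF l\<phi> t2] by simp
    then show "(\<integral>x. (adjoint_op A b ?\<psi>\<alpha> x - adjoint_op A b \<psi> (\<alpha> \<otimes> x)) * \<phi> x \<partial>lborel) = 0"
      by (simp add: algebra_simps)
  qed
  then show ?thesis by simp
qed

text \<open>Tested against \<open>\<psi>\<close>, the mollification is by Fubini's theorem a
  weighted average of the subsolution inequalities for the translates of \<open>u\<close>;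
  smoothness turns the weak inequality into a pointwise one.\<close>

lemma diff_op_mollify_nonneg:
  assumes u: "loc_integrable u"
    and sub: "\<And>\<psi>. \<psi> \<in> test_functions UNIV \<Longrightarrow> (\<And>x. 0 \<le> \<psi> x) \<Longrightarrow>
      0 \<le> (\<integral>x. u x * adjoint_op A b \<psi> x \<partial>lborel)"
    and \<phi>: "\<phi> \<in> test_functions UNIV" "\<And>x. 0 \<le> \<phi> x"
  shows "0 \<le> diff_op A b (mollify \<phi> u) x"
proof -
  note sw = smooth_on_mollify[OF u \<phi>(1)]
  have cL: "continuous_on UNIV (\<lambda>x. - diff_op A b (mollify \<phi> u) x)"
    by (intro continuous_on_minus smooth_on_continuous_on smooth_on_diff_op sw)
  have um [measurable]: "u \<in> borel_measurable borel" by (rule loc_integrable_measurable[OF u])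
  have "AE x in lborel. - diff_op A b (mollify \<phi> u) x \<le> 0"
  proof (rule AE_nonpos_of_test_functions[OF loc_integrable_continuous[OF cL]])
    fix \<psi> :: "real^'n \<Rightarrow> real" assume \<psi>: "\<psi> \<in> test_functions UNIV" "\<And>x. 0 \<le> \<psi> x"
    have [measurable]: "adjoint_op A b \<psi> \<in> borel_measurable borel"
      by (intro smooth_on_borel_measurable smooth_on_adjoint_op test_functions_smooth \<psi>)
    \<comment> \<open>The translation is shifted from \<open>u\<close> to \<open>\<psi>\<close>,
      which becomes another nonnegative test function.\<close>
    have "0 \<le> (\<integral>x. u (\<alpha> \<otimes> x) * adjoint_op A b \<psi> x \<partial>lborel)" for \<alpha>
    proof -
      let ?\<psi>\<alpha> = "\<lambda>y. \<psi> (inv \<alpha> \<otimes> y)"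
      have \<psi>\<alpha>: "?\<psi>\<alpha> \<in> test_functions UNIV"
        by (rule test_functions_left_translate[OF \<psi>(1)])
      have [measurable]: "adjoint_op A b ?\<psi>\<alpha> \<in> borel_measurable borel"
        by (intro smooth_on_borel_measurable smooth_on_adjoint_op test_functions_smooth \<psi>\<alpha>)
      have "(\<integral>x. u (\<alpha> \<otimes> x) * adjoint_op A b \<psi> x \<partial>lborel) = (\<integral>x. u x * adjoint_op A b \<psi> (inv \<alpha> \<otimes> x) \<partial>lborel)"
        using integral_left_translate[of "\<lambda>x. u x * adjoint_op A b \<psi> (inv \<alpha> \<otimes> x)" \<alpha>] by simp
      also have "\<dots> = (\<integral>x. u x * adjoint_op A b ?\<psi>\<alpha> x \<partial>lborel)"
        by (rule integral_cong_AE; (measurable)?)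
           (rule eventually_mono[OF adjoint_op_left_translate_AE[OF \<psi>(1), of "inv \<alpha>"]], simp)
      finally show ?thesis using sub[OF \<psi>\<alpha>] \<psi>(2) by simp
    qed
    then have "0 \<le> (\<integral>\<alpha>. (\<integral>x. u (\<alpha> \<otimes> x) * adjoint_op A b \<psi> x \<partial>lborel) * \<phi> \<alpha> \<partial>lborel)"
      using \<phi>(2) by (intro Bochner_Integration.integral_nonneg) simp
    also have "\<dots> = (\<integral>x. mollify \<phi> u x * adjoint_op A b \<psi> x \<partial>lborel)"
      by (rule integral_mollify_mult[OF u \<phi>(1) adjoint_op_test[OF \<psi>(1)], symmetric])
    also have "\<dots> = (\<integral>x. diff_op A b (mollify \<phi> u) x * \<psi> x \<partial>lborel)"
      by (rule integral_diff_op_adjoint_op[OF sw \<psi>(1)])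
    finally show "(\<integral>x. - diff_op A b (mollify \<phi> u) x * \<psi> x \<partial>lborel) \<le> 0" by simp
  qed
  then have "- diff_op A b (mollify \<phi> u) x \<in> {..0}"
    by (intro AE_closed_imp_all[OF _ cL]) auto
  then show ?thesis by simp
qed

text \<open>The weighted averages \<open>g\<close> of \<open>diff_op A b v\<close> are nonnegative,
  yet integrate to zero because \<open>v\<close> is integrable. Left invariance of the operator and
  right invariance of the measure are combined here.\<close>

lemma integrable_subsolution_imp_solution:
  assumes v: "smooth_on UNIV v" "integrable lborel v" and Lv: "\<And>x. 0 \<le> diff_op A b v x"
  shows "diff_op A b v x = 0"
proof -
  obtain \<psi> :: "real^'n \<Rightarrow> real" where \<psi>: "\<psi> \<in> test_functions UNIV" "\<And>x. 0 \<le> \<psi> x" "0 < \<psi> \<one>"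
    using ex_test_function_pos[of \<one>] by metis
  let ?h = "adjoint_op A b \<psi>"
  have h: "?h \<in> test_functions UNIV" by (rule adjoint_op_test[OF \<psi>(1)])
  have [measurable]: "v \<in> borel_measurable borel" "?h \<in> borel_measurable borel"
    by (intro smooth_on_borel_measurable v test_functions_smooth h)+
  have vm: "(\<lambda>x. v x) \<in> borel_measurable borel" "(\<lambda>x. \<bar>v x\<bar>) \<in> borel_measurable borel"
    by measurable
  have ih: "integrable lborel ?h"
    using loc_integrable_mult_test[OF loc_integrable_continuous[of "\<lambda>x. 1"] h] by simp
  \<comment> \<open>Green's formula with the constant function 1, which the operator
    annihilates.\<close>
  have h0: "(\<integral>z. ?h z \<partial>lborel) = 0"
    using integral_diff_op_adjoint_op[OF smooth_on_const \<psi>(1), of 1] by (simp add: diff_op_const)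
  have int: "integrable (lborel \<Otimes>\<^sub>M lborel) (\<lambda>(z, y). v (y \<otimes> z) * ?h z)"
  proof (rule lborel_pair.Fubini_integrable)
    have "(\<integral>y. norm (case (z, y) of (z, y) \<Rightarrow> v (y \<otimes> z) * ?h z) \<partial>lborel) = (\<integral>y. \<bar>v y\<bar> \<partial>lborel) * \<bar>?h z\<bar>" for z
      by (simp add: abs_mult integral_right_translate[OF vm(2)])
    then show "integrable lborel (\<lambda>z. \<integral>y. norm (case (z, y) of (z, y) \<Rightarrow> v (y \<otimes> z) * ?h z) \<partial>lborel)"
      using ih by simp
    show "AE z in lborel. integrable lborel (\<lambda>y. case (z, y) of (z, y) \<Rightarrow> v (y \<otimes> z) * ?h z)"
      using v(2) integrable_right_translate[OF vm(1)] by simp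
  qed measurable
  define g where "g y = (\<integral>z. v (y \<otimes> z) * ?h z \<partial>lborel)" for y
  have ig: "integrable lborel g"
    using lborel_pair.integrable_snd[OF int] by (simp add: g_def[abs_def])
  have "(\<integral>y. g y \<partial>lborel) = (\<integral>z. (\<integral>y. v (y \<otimes> z) * ?h z \<partial>lborel) \<partial>lborel)"
    unfolding g_def by (rule lborel_pair.Fubini_integral[OF int])
  \<comment> \<open>For fixed \<open>z\<close>, right invariance makes the inner integral the
    product of \<open>?h z\<close> and the integral of \<open>v\<close>; integrating over
    \<open>z\<close> leaves the factor \<open>h0\<close>.\<close>
  also have "\<dots> = 0"
    by (simp add: integral_right_translate[OF vm(1)] h0)
  finally have g0: "(\<integral>y. g y \<partial>lborel) = 0" .
  \<comment> \<open>Moving the adjoint back onto \<open>v\<close> uses that the operator commutes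
    with the left translation by \<open>y\<close>; this form shows the sign of
    \<open>g\<close>.\<close>
  have g_eq: "g y = (\<integral>z. diff_op A b v (y \<otimes> z) * \<psi> z \<partial>lborel)" for y
    unfolding g_def
    using integral_diff_op_adjoint_op[OF smooth_on_compose[OF v(1) smooth_on_translate(1)] \<psi>(1)]
    by (simp add: diff_op_left_translate[OF v(1)])
  have gn: "0 \<le> g y" for y
    unfolding g_eq by (intro Bochner_Integration.integral_nonneg mult_nonneg_nonneg Lv \<psi>)
  have "AE y in lborel. g y = 0"
    using integral_nonneg_eq_0_iff_AE[OF ig] g0 gn by simp
  moreover have "diff_op A b v y = 0" if "g y = 0" for y
  proof -
    let ?f = "\<lambda>z. diff_op A b v (y \<otimes> z) * \<psi> z"
    have s: "smooth_on UNIV (\<lambda>z. diff_op A b v (y \<otimes> z))"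
      by (rule smooth_on_compose[OF smooth_on_diff_op[OF v(1)] smooth_on_translate(1)])
    have c: "continuous_on UNIV ?f"
      by (intro smooth_on_continuous_on smooth_on_mult s test_functions_smooth \<psi>)
    have i: "integrable lborel ?f"
      by (intro loc_integrable_mult_test loc_integrable_continuous smooth_on_continuous_on s \<psi>)
    have "AE z in lborel. ?f z = 0"
      using integral_nonneg_eq_0_iff_AE[OF i] that Lv \<psi>(2) unfolding g_eq by simp
    \<comment> \<open>The bump is positive at the neutral element, so evaluation there recovers the
      value of \<open>diff_op A b v\<close> at \<open>y\<close> itself.\<close>
    then have "?f \<one> \<in> {0}"
      by (intro AE_closed_imp_all[OF _ c]) auto
    then show ?thesis using \<psi>(3) by simp
  qed
  ultimately have "AE y in lborel. diff_op A b v y \<in> {0}"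
    by (auto elim: eventually_mono)
  then have "diff_op A b v x \<in> {0}"
    by (rule AE_closed_imp_all[OF _ smooth_on_continuous_on[OF smooth_on_diff_op[OF v(1)]]]) simp
  then show ?thesis by simp
qed

text \<open>The superlevel set has an indicator that solves the equation in the sense of
  distributions. Hypoellipticity gives it a continuous representative, and connectedness of the
  space leaves only the null set and the full set.\<close>

lemma level_set_trivial:
  assumes hypo: "hypoelliptic A b" and w: "smooth_on UNIV w" and c: "0 \<le> c"
    and Lw: "\<And>x. 0 < w x \<Longrightarrow> diff_op A b w x = 0"
    and Aw: "\<And>x. 0 < w x \<Longrightarrow> (A x *v grad w x) \<bullet> grad w x = 0"
  shows "(AE x in lborel. w x \<le> c) \<or> (AE x in lborel. c < w x)"
proof -
  define S where "S = {x. c < w x}"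
  have [measurable]: "w \<in> borel_measurable borel" by (rule smooth_on_borel_measurable[OF w])
  have S [measurable]: "S \<in> sets borel" unfolding S_def by measurable
  have lS: "loc_integrable (indicator S)"
    unfolding loc_integrable_def set_integrable_def
  proof (intro conjI allI impI)
    fix K :: "(real^'n) set" assume "compact K"
    then have "emeasure lborel K < \<infinity>" "K \<in> sets lborel"
      using emeasure_bounded_finite[OF compact_imp_bounded] by (auto intro: borel_compact)
    then show "integrable lborel (\<lambda>x. indicator K x *\<^sub>R (indicator S x :: real))"
      using integrable_mult_indicator[of S lborel "indicator K :: _ \<Rightarrow> real"] integrable_real_indicator[of K lborel]
      by (simp add: mult.commute)
  qed measurable
  define T where "T \<phi> = (\<integral>x. indicator S x * \<phi> x \<partial>lborel)" for \<phi> :: "real^'n \<Rightarrow> real"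
  have "distribution_on UNIV T"
    unfolding distribution_on_def
  proof (intro conjI ballI allI impI)
    fix \<phi> \<psi> :: "real^'n \<Rightarrow> real"
    assume "\<phi> \<in> test_functions UNIV" "\<psi> \<in> test_functions UNIV"
    then show "T (\<lambda>x. \<phi> x + \<psi> x) = T \<phi> + T \<psi>"
      using loc_integrable_mult_test[OF lS] by (simp add: T_def distrib_left)
  next
    show "T (\<lambda>x. c * \<phi> x) = c * T \<phi>" for c and \<phi> :: "real^'n \<Rightarrow> real"
      by (simp add: T_def mult.left_commute)
  next
    fix K :: "(real^'n) set" assume K: "compact K \<and> K \<subseteq> UNIV"
    then have fin: "emeasure lborel K < \<infinity>" "K \<in> sets lborel"
      using emeasure_bounded_finite[OF compact_imp_bounded] by (auto intro: borel_compact)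
    \<comment> \<open>The distribution has order zero: only the empty multi-index enters
      \<open>Ck_norm 0\<close>, and the constant is the volume of \<open>K\<close>.\<close>
    have "\<bar>T \<phi>\<bar> \<le> measure lborel K * Ck_norm 0 \<phi>"
      if \<phi>: "\<phi> \<in> test_functions UNIV" "supp \<phi> \<subseteq> K" for \<phi>
    proof -
      have z: "\<phi> x = 0" if "x \<notin> K" for x
        using that \<phi>(2) in_supp by (metis subsetD)
      obtain C where C: "\<And>x. \<bar>\<phi> x\<bar> \<le> C"
        using continuous_compact_bounded[OF smooth_on_continuous_on[OF test_functions_smooth[OF \<phi>(1)]] _ z] K
        by metis
      have "{is :: 'n list. length is \<le> 0} = {[]}" by auto
      then have Ck: "Ck_norm 0 \<phi> = (SUP x. \<bar>\<phi> x\<bar>)"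
        by (simp add: Ck_norm_def)
      have le: "\<bar>\<phi> x\<bar> \<le> Ck_norm 0 \<phi>" for x
        unfolding Ck by (rule cSUP_upper) (auto intro: bdd_aboveI[of _ C] C)
      have "\<bar>T \<phi>\<bar> \<le> (\<integral>x. norm (indicator S x * \<phi> x) \<partial>lborel)"
        unfolding T_def by (metis integral_norm_bound real_norm_def)
      also have "\<dots> \<le> (\<integral>x. Ck_norm 0 \<phi> * indicator K x \<partial>lborel)"
      proof (rule integral_mono)
        show "integrable lborel (\<lambda>x. norm (indicator S x * \<phi> x))"
          by (intro integrable_norm loc_integrable_mult_test lS \<phi>)
        show "integrable lborel (\<lambda>x. Ck_norm 0 \<phi> * indicator K x)"
          using fin by (intro integrable_mult_right integrable_real_indicator)
        show "norm (indicator S x * \<phi> x) \<le> Ck_norm 0 \<phi> * indicator K x" for x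
          using le[of x] z[of x] by (auto simp: indicator_def)
      qed
      also have "\<dots> = measure lborel K * Ck_norm 0 \<phi>"
        using fin by simp
      finally show ?thesis .
    qed
    then show "\<exists>C m. \<forall>\<phi>\<in>test_functions UNIV. supp \<phi> \<subseteq> K \<longrightarrow> \<bar>T \<phi>\<bar> \<le> C * Ck_norm m \<phi>"
      by blast
  qed
  moreover have "T (adjoint_op A b \<phi>) = 0" if \<phi>: "\<phi> \<in> test_functions UNIV" for \<phi>
  proof -
    let ?h = "adjoint_op A b \<phi>"
    have h: "?h \<in> test_functions UNIV" by (rule adjoint_op_test[OF \<phi>])
    have [measurable]: "?h \<in> borel_measurable borel" "flat m \<in> borel_measurable borel" for m
      by (intro smooth_on_borel_measurable test_functions_smooth h smooth_on_flat)+
    have ih: "integrable lborel ?h"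
      using loc_integrable_mult_test[OF loc_integrable_continuous[of "\<lambda>x. 1"] h] by simp
    \<comment> \<open>The smooth approximations \<open>flat 0 (k * (t - c))\<close> of the step at
      \<open>c\<close> are zero for \<open>t \<le> c\<close>. Composed with \<open>w\<close> they
      are classical solutions: where \<open>w > c \<ge> 0\<close> both terms of the chain rule
      vanish by \<open>Lw\<close> and \<open>Aw\<close>, elsewhere the derivatives of the
      approximation are zero.\<close>
    have zero: "(\<integral>x. flat 0 (real k * (w x - c)) * ?h x \<partial>lborel) = 0" for k
    proof -
      let ?H = "\<lambda>t. flat 0 (real k * (t - c))" and ?H' = "\<lambda>t. real k * flat 2 (real k * (t - c))"
        and ?H'' = "\<lambda>t. real k * (real k * (flat 4 (real k * (t - c)) - 2 * flat 3 (real k * (t - c))))"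
      have lin: "((\<lambda>t. real k * (t - c)) has_real_derivative real k) (at t)" for t
        by (auto intro!: derivative_eq_intros)
      have sl: "smooth_on UNIV (\<lambda>t. real k * (t - c))"
        by (intro smooth_on_mult smooth_on_diff smooth_on_const smooth_on_bounded_linear bounded_linear_ident)
      have D1: "(?H has_real_derivative ?H' t) (at t)" for t
        using DERIV_chain2[OF flat_has_derivative lin, of 0 t] by (simp add: mult.commute numeral_2_eq_2)
      have D2: "(?H' has_real_derivative ?H'' t) (at t)" for t
        using DERIV_cmult[OF DERIV_chain2[OF flat_has_derivative lin, of 2 t], of "real k"]
        by (simp add: mult.commute)
      have "smooth_on UNIV ?H'"
        by (intro smooth_on_mult smooth_on_const smooth_on_compose[OF smooth_on_flat sl])
      note chain = diff_op_compose[OF w this D1 D2]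
      have "diff_op A b (\<lambda>x. ?H (w x)) x = 0" for x
      proof (cases "c < w x")
        case True
        then have "0 < w x" using c by simp
        then show ?thesis unfolding chain by (simp add: Lw Aw)
      next
        case False
        then have "real k * (w x - c) \<le> 0" by (simp add: mult_le_0_iff)
        then show ?thesis unfolding chain by (simp add: flat_def)
      qed
      moreover have "smooth_on UNIV (\<lambda>x. ?H (w x))"
        by (rule smooth_on_compose[OF smooth_on_compose[OF smooth_on_flat sl] w])
      ultimately show ?thesis
        using integral_diff_op_adjoint_op[OF _ \<phi>, of "\<lambda>x. ?H (w x)"] by simp
    qed
    \<comment> \<open>Where \<open>w x > c\<close> the approximations are exp(-1/(k (w x - c))) for
      positive \<open>k\<close> and tend to 1; they are bounded by 1, so
      \<open>\<bar>?h x\<bar>\<close> dominates.\<close>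
    have "(\<lambda>k. \<integral>x. flat 0 (real k * (w x - c)) * ?h x \<partial>lborel) \<longlonglongrightarrow> (\<integral>x. indicator S x * ?h x \<partial>lborel)"
    proof (rule integral_dominated_convergence)
      show "integrable lborel (\<lambda>x. \<bar>?h x\<bar>)" using ih by (rule integrable_abs)
      have "\<bar>flat 0 t\<bar> \<le> 1" for t by (simp add: flat_def)
      then show "AE x in lborel. norm (flat 0 (real k * (w x - c)) * ?h x) \<le> \<bar>?h x\<bar>" for k
        using mult_right_mono[of _ 1 "\<bar>?h _\<bar>"] by (auto simp: abs_mult)
      show "AE x in lborel. (\<lambda>k. flat 0 (real k * (w x - c)) * ?h x) \<longlonglongrightarrow> indicator S x * ?h x"
      proof (intro AE_I2 tendsto_mult_right)
        fix x
        show "(\<lambda>k. flat 0 (real k * (w x - c))) \<longlonglongrightarrow> indicator S x"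
        proof (cases "c < w x")
          case True
          define d where "d = w x - c"
          have d: "d > 0" using True by (simp add: d_def)
          then have "(\<lambda>k. exp (- 1 / (real k * d))) \<longlonglongrightarrow> 1" by real_asymp
          moreover have "\<forall>\<^sub>F k in sequentially. exp (- 1 / (real k * d)) = flat 0 (real k * d)"
            using eventually_gt_at_top[of 0] by (rule eventually_mono) (simp add: flat_def d)
          ultimately have "(\<lambda>k. flat 0 (real k * d)) \<longlonglongrightarrow> 1"
            by (rule Lim_transform_eventually)
          then show ?thesis using True by (simp add: d_def S_def)
        next
          case False
          then have "\<not> 0 < real k * (w x - c)" for k
            by (simp add: zero_less_mult_iff)
          then show ?thesis using False by (simp add: flat_def S_def)
        qed
      qed
    qed measurable
    then show ?thesis
      unfolding zero T_def by (simp add: LIMSEQ_const_iff)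
  qed
  then have "smooth_distribution_on UNIV (\<lambda>\<phi>. T (adjoint_op A b \<phi>))"
    unfolding smooth_distribution_on_def by (intro exI[of _ "\<lambda>x. 0"]) auto
  ultimately have "smooth_distribution_on UNIV T"
    using hypo open_UNIV unfolding hypoelliptic_def by blast
  then obtain f where f: "smooth_on UNIV f"
      "\<And>\<phi>. \<phi> \<in> test_functions UNIV \<Longrightarrow> T \<phi> = (LINT x|lebesgue. f x * \<phi> x)"
    unfolding smooth_distribution_on_def by blast
  have [measurable]: "f \<in> borel_measurable borel" by (rule smooth_on_borel_measurable[OF f(1)])
  have lf: "loc_integrable f" by (intro loc_integrable_continuous smooth_on_continuous_on f)
  have "AE x in lborel. indicator S x - f x = 0"
  proof (rule AE_eq_0_of_test_functions)
    show "loc_integrable (\<lambda>x. indicator S x - f x)"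
      using lS lf by (auto simp: loc_integrable_def intro: set_integral_diff)
    fix \<phi> :: "real^'n \<Rightarrow> real" assume \<phi>: "\<phi> \<in> test_functions UNIV"
    have [measurable]: "\<phi> \<in> borel_measurable borel"
      by (intro smooth_on_borel_measurable test_functions_smooth \<phi>)
    have "T \<phi> = (\<integral>x. f x * \<phi> x \<partial>lborel)"
      unfolding f(2)[OF \<phi>] by (rule integral_completion) measurable
    then show "(\<integral>x. (indicator S x - f x) * \<phi> x \<partial>lborel) = 0"
      using loc_integrable_mult_test[OF lS \<phi>] loc_integrable_mult_test[OF lf \<phi>]
      by (simp add: T_def left_diff_distrib)
  qed
  then have fS: "AE x in lborel. f x = indicator S x"
    by (rule eventually_mono) simp
  have cf: "continuous_on UNIV f" by (rule smooth_on_continuous_on[OF f(1)])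
  have "AE x in lborel. f x \<in> {0, 1}"
    using fS by (rule eventually_mono) (auto simp: indicator_def)
  then have "f x \<in> {0, 1}" for x
    by (rule AE_closed_imp_all[OF _ cf]) simp
  \<comment> \<open>A continuous function with finite range on a connected space is
    constant.\<close>
  then have "finite (range f)"
    by (intro finite_subset[of "range f" "{0, 1}"]) auto
  then have "f constant_on UNIV"
    by (intro continuous_finite_range_constant cf) (auto simp: connected_UNIV)
  then obtain a where "\<And>x. f x = a" by (auto simp: constant_on_def)
  with fS have a: "AE x in lborel. a = indicator S x" by simp
  show ?thesis
  proof (cases "a = 1")
    case True
    have "AE x in lborel. c < w x"
      using a by (rule eventually_mono) (use True in \<open>auto simp: S_def indicator_def split: if_splits\<close>)
    then show ?thesis ..
  next
    case False
    have "AE x in lborel. w x \<le> c"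
      using a by (rule eventually_mono) (use False in \<open>auto simp: S_def indicator_def split: if_splits\<close>)
    then show ?thesis ..
  qed
qed

lemma smooth_subsolution_nonpos:
  assumes hypo: "hypoelliptic A b" and w: "smooth_on UNIV w"
    and Lw: "\<And>x. 0 \<le> diff_op A b w x" and int: "integrable lborel (\<lambda>x. soft_pos (w x))"
  shows "w x \<le> 0"
proof -
  note chain = diff_op_compose[OF w smooth_on_soft_pos_deriv soft_pos_derivs]
  have n1: "0 \<le> (flat 0 (w x) + flat 1 (w x)) * diff_op A b w x" for x
    by (intro mult_nonneg_nonneg add_nonneg_nonneg flat_nonneg Lw)
  have n2: "0 \<le> flat 3 (w x) * ((A x *v grad w x) \<bullet> grad w x)" for x
    by (intro mult_nonneg_nonneg flat_nonneg A_nonneg)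
  have "diff_op A b (\<lambda>x. soft_pos (w x)) x = 0" for x
  proof (rule integrable_subsolution_imp_solution[OF _ int])
    show "smooth_on UNIV (\<lambda>x. soft_pos (w x))"
      by (rule smooth_on_compose[OF smooth_on_soft_pos w])
    show "0 \<le> diff_op A b (\<lambda>x. soft_pos (w x)) x" for x
      unfolding chain using n1 n2 by (rule add_nonneg_nonneg)
  qed
  \<comment> \<open>Both summands of the chain rule are nonnegative and their sum is zero, so each
    of them is zero.\<close>
  then have z: "(flat 0 (w x) + flat 1 (w x)) * diff_op A b w x = 0"
      "flat 3 (w x) * ((A x *v grad w x) \<bullet> grad w x) = 0" for x
    using n1[of x] n2[of x] unfolding chain by (metis add_nonneg_eq_0_iff)+
  have pos: "0 < flat m (w x)" if "0 < w x" for m x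
    using that by (simp add: flat_pos_iff)
  have Lw0: "diff_op A b w x = 0" if "0 < w x" for x
    using z(1)[of x] pos[OF that, of 0] pos[OF that, of 1] by simp
  have Aw0: "(A x *v grad w x) \<bullet> grad w x = 0" if "0 < w x" for x
    using z(2)[of x] pos[OF that, of 3] by simp
  \<comment> \<open>A level \<open>c > 0\<close> gives the positive lower bound
    \<open>soft_pos c\<close> on \<open>{w > c}\<close>, and a positive constant is not integrable
    on a space of infinite measure. At level 0 this bound would degenerate, so the claim follows by
    letting \<open>c\<close> tend to 0.\<close>
  have le: "w x \<le> c" if c: "0 < c" for c x
  proof -
    have "\<not> (AE x in lborel. c < w x)"
    proof
      assume "AE x in lborel. c < w x"
      then have "AE x in lborel. soft_pos c \<le> soft_pos (w x)"
        by (rule eventually_mono) (intro soft_pos_mono less_imp_le)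
      then have "AE x :: real^'n in lborel. norm (soft_pos c) \<le> norm (soft_pos (w x))"
        by (rule eventually_mono) (simp add: soft_pos_nonneg)
      then have "integrable lborel (\<lambda>x :: real^'n. soft_pos c)"
        by (intro Bochner_Integration.integrable_bound[OF int]) auto
      then have "integrable lborel (indicator UNIV :: real^'n \<Rightarrow> real)"
        using integrable_mult_right[of "inverse (soft_pos c)" lborel "\<lambda>x :: real^'n. soft_pos c"]
          soft_pos_pos[OF c] by simp
      then show False
        by (subst (asm) integrable_indicator_iff) simp
    qed
    then have "AE x in lborel. w x \<in> {..c}"
      using level_set_trivial[OF hypo w _ Lw0 Aw0, of c] c by simp
    then have "w x \<in> {..c}"
      by (rule AE_closed_imp_all[OF _ smooth_on_continuous_on[OF w]]) simp
    then show ?thesis by simp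
  qed
  show ?thesis
    by (rule field_le_epsilon) (use le in simp)
qed

lemma weak_subsolution_AE_nonpos:
  assumes hypo: "hypoelliptic A b" and u: "loc_integrable u"
    and sub: "\<And>\<psi>. \<psi> \<in> test_functions UNIV \<Longrightarrow> (\<And>x. 0 \<le> \<psi> x) \<Longrightarrow>
      0 \<le> (\<integral>x. u x * adjoint_op A b \<psi> x \<partial>lborel)"
    and int: "integrable lborel (\<lambda>x. soft_pos (u x))"
  shows "AE x in lborel. u x \<le> 0"
proof (rule AE_nonpos_of_test_functions[OF u])
  fix \<phi> :: "real^'n \<Rightarrow> real" assume \<phi>: "\<phi> \<in> test_functions UNIV" "\<And>x. 0 \<le> \<phi> x"
  note s\<phi> = test_functions_smooth[OF \<phi>(1)]
  have i\<phi>: "integrable lborel \<phi>"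
    using loc_integrable_mult_test[OF loc_integrable_continuous[of "\<lambda>x. 1"] \<phi>(1)] by simp
  define c where "c = (\<integral>x. \<phi> x \<partial>lborel)"
  show "(\<integral>x. u x * \<phi> x \<partial>lborel) \<le> 0"
  proof (cases "c = 0")
    \<comment> \<open>A weight of mass zero cannot be normalized, but being nonnegative it vanishes
      almost everywhere.\<close>
    case True
    then have "AE x in lborel. \<phi> x = 0"
      using integral_nonneg_eq_0_iff_AE[OF i\<phi>] \<phi>(2) by (simp add: c_def)
    then have "AE x in lborel. u x * \<phi> x = 0" by (rule eventually_mono) simp
    then have "(\<integral>x. u x * \<phi> x \<partial>lborel) = 0" by (rule integral_eq_zero_AE)
    then show ?thesis by simp
  next
    case False
    moreover have "0 \<le> c" unfolding c_def by (intro Bochner_Integration.integral_nonneg \<phi>)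
    ultimately have c: "0 < c" by simp
    define \<eta> where "\<eta> x = inverse c * \<phi> x" for x
    have \<eta>0: "0 \<le> \<eta> x" for x using c \<phi>(2) by (simp add: \<eta>_def)
    have \<eta>: "\<eta> \<in> test_functions UNIV"
    proof (rule test_functionsI)
      show "smooth_on UNIV \<eta>" unfolding \<eta>_def by (intro smooth_on_mult smooth_on_const s\<phi>)
      show "compact (supp \<phi>)" by (rule test_functions_compact[OF \<phi>(1)])
      show "\<eta> x = 0" if "x \<notin> supp \<phi>" for x using that in_supp[of \<phi> x] by (auto simp: \<eta>_def)
    qed
    have \<eta>1: "(\<integral>x. \<eta> x \<partial>lborel) = 1" using c by (simp add: \<eta>_def c_def)
    \<comment> \<open>At the neutral element the average is the integral of \<open>u\<close> against
      the normalized weight, so the pointwise sign of the mollification is the weak sign of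
      \<open>u\<close>.\<close>
    have "mollify \<eta> u \<one> \<le> 0"
      by (rule smooth_subsolution_nonpos[OF hypo smooth_on_mollify[OF u \<eta>]
            diff_op_mollify_nonneg[OF u sub \<eta> \<eta>0] integrable_soft_pos_mollify[OF u int \<eta> \<eta>0 \<eta>1]])
    also have "mollify \<eta> u \<one> = inverse c * (\<integral>x. u x * \<phi> x \<partial>lborel)"
      by (simp add: mollify_def \<eta>_def mult.left_commute)
    finally show ?thesis using c by (simp add: mult_le_0_iff)
  qed
qed

end

section \<open>Reduction of Lebesgue measurable subsolutions to Borel measurable ones\<close>

theorem theorem1p3:
  fixes A :: "real^'n \<Rightarrow> real^'n^'n::finite"
    and b :: "real^'n \<Rightarrow> real^'n"
    and G :: "(real^'n) monoid"
    and u :: "real^'n \<Rightarrow> real"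
    and p :: real
  assumes A_smooth: "\<And>i j. smooth_on UNIV (\<lambda>x. A x $ i $ j)"
    and b_smooth: "\<And>j. smooth_on UNIV (\<lambda>x. b x $ j)"
    and A_symmetric: "\<And>x. transpose (A x) = A x"
    and A_nonneg: "\<And>x \<xi>. (A x *v \<xi>) \<bullet> \<xi> \<ge> 0"
    and A_trace: "trace (A 0) > 0"
    and hypo: "hypoelliptic A b"
    and lie: "lie_group G"
    and L_invariant: "left_translation_invariant_op G (diff_op A b)"
    and left_inv: "left_invariant_lebesgue G"
    and right_inv: "right_invariant_lebesgue G"
    and u_loc: "u \<in> L1_loc"
    and u_sub: "weak_subsolution A b u"
    and p: "p \<ge> 1"
    and u_Lp: "u \<in> Lp p"
  shows "AE x in lebesgue. u x \<le> 0"
proof -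
  interpret invariant_operator A b G
    by unfold_locales fact+
  have um: "u \<in> borel_measurable lebesgue" and up: "integrable lebesgue (\<lambda>x. \<bar>u x\<bar> powr p)"
    using u_Lp by (auto simp: Lp_def)
  \<comment> \<open>The preceding results concern Borel functions and \<open>lborel\<close>, while
    \<open>u\<close> is only Lebesgue measurable. The hypotheses involve \<open>u\<close> through
    integrals alone, so they pass to a Borel representative \<open>v\<close>.\<close>
  obtain v where v [measurable]: "v \<in> borel_measurable borel" and uv: "AE x in lborel. u x = v x"
    using completion_ex_borel_measurable_real[OF um] by auto
  have uv': "AE x in lebesgue. u x = v x" by (rule AE_completion[OF uv])
  have transfer: "integrable lborel f"
    if "integrable lebesgue g" "f \<in> borel_measurable borel" "AE x in lebesgue. g x = f x" for f g :: "real^'n \<Rightarrow> real"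
  proof -
    have "f \<in> borel_measurable lebesgue"
      using that(2) by (intro measurable_completion) simp
    then have "integrable lebesgue f"
      by (rule integrable_cong_AE_imp[OF that(1) _ that(3)])
    then show ?thesis using that(2) by (simp add: integrable_completion)
  qed
  have "loc_integrable v"
    unfolding loc_integrable_def
  proof (intro conjI allI impI v)
    fix K :: "(real^'n) set" assume K: "compact K"
    then have [measurable]: "K \<in> sets borel" by (rule borel_compact)
    have i: "integrable lebesgue (\<lambda>x. indicator K x *\<^sub>R u x)"
      using u_loc K by (auto simp: L1_loc_def set_integrable_def)
    have ae: "AE x in lebesgue. indicator K x *\<^sub>R u x = indicator K x *\<^sub>R v x"
      using uv' by (rule eventually_mono) simp
    show "set_integrable lborel K v"
      unfolding set_integrable_def by (rule transfer[OF i _ ae]) measurable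
  qed
  moreover have "0 \<le> (\<integral>x. v x * adjoint_op A b \<psi> x \<partial>lborel)"
    if \<psi>: "\<psi> \<in> test_functions UNIV" "\<And>x. 0 \<le> \<psi> x" for \<psi>
  proof -
    have [measurable]: "adjoint_op A b \<psi> \<in> borel_measurable borel"
      by (intro smooth_on_borel_measurable smooth_on_adjoint_op test_functions_smooth \<psi>)
    have hm: "adjoint_op A b \<psi> \<in> borel_measurable lebesgue" "v \<in> borel_measurable lebesgue"
      by (intro measurable_completion; simp)+
    have "0 \<le> (LINT x|lebesgue. u x * adjoint_op A b \<psi> x)"
      using u_sub \<psi> by (simp add: weak_subsolution_def)
    also have "\<dots> = (LINT x|lebesgue. v x * adjoint_op A b \<psi> x)"
      by (intro integral_cong_AE borel_measurable_times um hm) (rule eventually_mono[OF uv'], simp)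
    also have "\<dots> = (\<integral>x. v x * adjoint_op A b \<psi> x \<partial>lborel)"
      by (rule integral_completion) measurable
    finally show ?thesis .
  qed
  moreover have "integrable lborel (\<lambda>x. soft_pos (v x))"
  proof (rule Bochner_Integration.integrable_bound)
    have "integrable lborel (\<lambda>x. \<bar>v x\<bar> powr p)"
      by (rule transfer[OF up]) (measurable, rule eventually_mono[OF uv'], simp)
    then show "integrable lborel (\<lambda>x. (1 + p powr p) * \<bar>v x\<bar> powr p)"
      by (rule integrable_mult_right)
    have [measurable]: "soft_pos \<in> borel_measurable borel"
      by (rule smooth_on_borel_measurable[OF smooth_on_soft_pos])
    show "(\<lambda>x. soft_pos (v x)) \<in> borel_measurable lborel" by measurable
    show "AE x in lborel. norm (soft_pos (v x)) \<le> norm ((1 + p powr p) * \<bar>v x\<bar> powr p)"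
      using soft_pos_le_powr[OF p] soft_pos_nonneg by (intro AE_I2) (simp add: order_trans[OF _ abs_ge_self])
  qed
  ultimately have "AE x in lborel. v x \<le> 0"
    by (rule weak_subsolution_AE_nonpos[OF hypo])
  then have "AE x in lebesgue. v x \<le> 0" by (rule AE_completion)
  with uv' show ?thesis by eventually_elim simp
qed

end
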